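(* Let $R>0$, let $N\ge1$ be an integer, let $0<r\le R$, and let $f\colon\mathbb{R}^N\to\mathbb{R}^N$ be continuous. If $|f(x)|=O(|x|^\alpha)$ as $|x|\to\infty$ for some $\alpha\ge1$, then for all $\alpha\le p<\infty$, the solution semiflow $\varPhi_r\colon\mathbb{R}_+\times\bar{\mathcal{L}}^p([-R,0],\mathbb{R}^N)\to\bar{\mathcal{L}}^p([-R,0],\mathbb{R}^N)$ of $\dot x(t)=f(x(t-r))$ given by $$\varPhi_r(t,\phi):=R_tx(\cdot;\phi,r)$$ is a continuous semiflow.
   Context: $\mathbb{R}_+=[0,\infty)$ and $|\cdot|$ is a fixed norm on $\mathbb{R}^N$. For $1\le p<\infty$, $\bar{\mathcal{L}}^p([-R,0],\mathbb{R}^N)$ is the linear space of Lebesgue measurable functions $\phi\colon[-R,0]\to\mathbb{R}^N$ (actual functions, not equivalence classes) with $\int_{-R}^0|\phi|^p<\infty$, endowed with the seminorm $\|\phi\|_{\bar{\mathcal{L}}^p[-R,0]}=\left(\int_{-R}^0|\phi(\theta)|^p\,d\theta+|\phi(0)|^p\right)^{1/p}$ and the topology it induces. Solution: $x(\cdot;\phi,r)\colon[-R,\infty)\to\mathbb{R}^N$ is the unique function which equals $\phi$ on $[-R,0]$, is continuous on $[0,\infty)$, and satisfies $x(t)=\phi(0)+\int_0^t f(x(s-r))\,ds$ for all $t\ge0$ (constructed by the method of steps; on $[0,r]$ it equals $\phi(0)+\int_0^t f(\phi(s-r))\,ds$). The history of $x$ at $t\ge0$ is $R_tx\colon[-R,0]\to\mathbb{R}^N$,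 $(R_tx)(\theta)=x(t+\theta)$. A semiflow in a set $X$ is a map $\varPhi\colon\mathbb{R}_+\times X\to X$ with $\varPhi(0,x)=x$ and $\varPhi(t+s,x)=\varPhi(s,\varPhi(t,x))$ for all $t,s\in\mathbb{R}_+$, $x\in X$. When $X$ is a topological space, it is a continuous semiflow if the map $\varPhi$ is (jointly) continuous on $\mathbb{R}_+\times X$. $|f(x)|=O(|x|^\alpha)$ as $|x|\to\infty$ means that there are $C,K>0$ with $|f(x)|\le C|x|^\alpha$ whenever $|x|\ge K$. *)

theory Defs
  imports "HOL-Analysis.Analysis"
begin

definition is_norm :: "('a::real_vector \<Rightarrow> real) \<Rightarrow> bool" where
  "is_norm nrm \<longleftrightarrow>
     (\<forall>x. nrm x = 0 \<longleftrightarrow> x = 0) \<and>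
     (\<forall>c x. nrm (c *\<^sub>R x) = \<bar>c\<bar> * nrm x) \<and>
     (\<forall>x y. nrm (x + y) \<le> nrm x + nrm y)"

text \<open>
  A function with domain \<open>D \<subseteq> \<real>\<close> is an element of \<^const>\<open>extensional\<close> \<open>D\<close>, so that equality of
  HOL functions is equality of functions on \<open>D\<close>. In particular the elements of the following space
  are functions on \<open>[-R,0]\<close>, not equivalence classes modulo null sets.
\<close>

definition Lp_space ::
  "(real ^ 'n \<Rightarrow> real) \<Rightarrow> real \<Rightarrow> real \<Rightarrow> (real \<Rightarrow> real ^ 'n) set" where
  "Lp_space nrm p R =
     {\<phi> \<in> extensional {-R..0}.
        \<phi> \<in> borel_measurable (lebesgue_on {-R..0}) \<and>
        integrable (lebesgue_on {-R..0}) (\<lambda>\<theta>. nrm (\<phi> \<theta>) powr p)}"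

definition Lp_seminorm ::
  "(real ^ 'n \<Rightarrow> real) \<Rightarrow> real \<Rightarrow> real \<Rightarrow> (real \<Rightarrow> real ^ 'n) \<Rightarrow> real" where
  "Lp_seminorm nrm p R \<phi> =
     ((\<integral>\<theta>. nrm (\<phi> \<theta>) powr p \<partial>lebesgue_on {-R..0}) + nrm (\<phi> 0) powr p) powr (1 / p)"

definition Lp_topology ::
  "(real ^ 'n \<Rightarrow> real) \<Rightarrow> real \<Rightarrow> real \<Rightarrow> (real \<Rightarrow> real ^ 'n) topology" where
  "Lp_topology nrm p R =
     topology (\<lambda>U. U \<subseteq> Lp_space nrm p R \<and>
       (\<forall>\<phi>\<in>U. \<exists>\<epsilon>>0. \<forall>\<psi>\<in>Lp_space nrm p R.
          Lp_seminorm nrm p R (\<lambda>\<theta>. \<psi> \<theta> - \<phi> \<theta>) < \<epsilon> \<longrightarrow> \<psi> \<in> U))"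

lemma openin_Lp_topology:
  "openin (Lp_topology nrm p R) U \<longleftrightarrow>
     U \<subseteq> Lp_space nrm p R \<and>
       (\<forall>\<phi>\<in>U. \<exists>\<epsilon>>0. \<forall>\<psi>\<in>Lp_space nrm p R.
          Lp_seminorm nrm p R (\<lambda>\<theta>. \<psi> \<theta> - \<phi> \<theta>) < \<epsilon> \<longrightarrow> \<psi> \<in> U)"
proof -
  define P where "P = (\<lambda>U. U \<subseteq> Lp_space nrm p R \<and>
       (\<forall>\<phi>\<in>U. \<exists>\<epsilon>>0. \<forall>\<psi>\<in>Lp_space nrm p R.
          Lp_seminorm nrm p R (\<lambda>\<theta>. \<psi> \<theta> - \<phi> \<theta>) < \<epsilon> \<longrightarrow> \<psi> \<in> U))"
  have "istopology P"
    unfolding istopology_def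
  proof (intro conjI allI impI)
    fix S T assume S: "P S" and T: "P T"
    show "P (S \<inter> T)"
      unfolding P_def
    proof (intro conjI ballI)
      show "S \<inter> T \<subseteq> Lp_space nrm p R" using S by (auto simp: P_def)
      fix \<phi> assume "\<phi> \<in> S \<inter> T"
      then obtain d e where "d > 0" "e > 0"
        and d: "\<forall>\<psi>\<in>Lp_space nrm p R.
                  Lp_seminorm nrm p R (\<lambda>\<theta>. \<psi> \<theta> - \<phi> \<theta>) < d \<longrightarrow> \<psi> \<in> S"
        and e: "\<forall>\<psi>\<in>Lp_space nrm p R.
                  Lp_seminorm nrm p R (\<lambda>\<theta>. \<psi> \<theta> - \<phi> \<theta>) < e \<longrightarrow> \<psi> \<in> T"
        using S T unfolding P_def by blast
      then show "\<exists>\<epsilon>>0. \<forall>\<psi>\<in>Lp_space nrm p R.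
          Lp_seminorm nrm p R (\<lambda>\<theta>. \<psi> \<theta> - \<phi> \<theta>) < \<epsilon> \<longrightarrow> \<psi> \<in> S \<inter> T"
        by (intro exI[of _ "min d e"]) auto
    qed
  next
    fix \<K> assume "\<forall>K\<in>\<K>. P K"
    then show "P (\<Union>\<K>)" unfolding P_def by (auto, meson)
  qed
  then have "openin (topology P) = P" by (rule topology_inverse')
  then show ?thesis
    unfolding Lp_topology_def P_def[symmetric] by (simp add: P_def)
qed

lemma topspace_Lp_topology: "topspace (Lp_topology nrm p R) = Lp_space nrm p R"
proof
  show "topspace (Lp_topology nrm p R) \<subseteq> Lp_space nrm p R"
    using openin_topspace[of "Lp_topology nrm p R"] unfolding openin_Lp_topology by blast
  have "openin (Lp_topology nrm p R) (Lp_space nrm p R)"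
    unfolding openin_Lp_topology by (auto intro: exI[of _ 1])
  then show "Lp_space nrm p R \<subseteq> topspace (Lp_topology nrm p R)"
    by (rule openin_subset)
qed

text \<open>
  The integrability clause excludes the convention that a non-integrable function has integral 0.
\<close>

definition is_solution ::
  "(real ^ 'n \<Rightarrow> real ^ 'n) \<Rightarrow> real \<Rightarrow> real \<Rightarrow> (real \<Rightarrow> real ^ 'n) \<Rightarrow> (real \<Rightarrow> real ^ 'n) \<Rightarrow> bool" where
  "is_solution f R r \<phi> x \<longleftrightarrow>
     x \<in> extensional {-R..} \<and>
     (\<forall>\<theta>\<in>{-R..0}. x \<theta> = \<phi> \<theta>) \<and>
     continuous_on {0..} x \<and>
     (\<forall>t\<ge>0. integrable (lebesgue_on {0..t}) (\<lambda>s. f (x (s - r))) \<and>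
             x t = \<phi> 0 + (\<integral>s. f (x (s - r)) \<partial>lebesgue_on {0..t}))"

definition solution ::
  "(real ^ 'n \<Rightarrow> real ^ 'n) \<Rightarrow> real \<Rightarrow> real \<Rightarrow> (real \<Rightarrow> real ^ 'n) \<Rightarrow> (real \<Rightarrow> real ^ 'n)" where
  "solution f R r \<phi> = (THE x. is_solution f R r \<phi> x)"

definition history :: "real \<Rightarrow> real \<Rightarrow> (real \<Rightarrow> 'a) \<Rightarrow> (real \<Rightarrow> 'a)" where
  "history R t x = restrict (\<lambda>\<theta>. x (t + \<theta>)) {-R..0}"

definition solution_semiflow ::
  "(real ^ 'n \<Rightarrow> real ^ 'n) \<Rightarrow> real \<Rightarrow> real \<Rightarrow> real \<times> (real \<Rightarrow> real ^ 'n) \<Rightarrow> (real \<Rightarrow> real ^ 'n)" where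
  "solution_semiflow f R r = (\<lambda>(t, \<phi>). history R t (solution f R r \<phi>))"

definition semiflow :: "'x set \<Rightarrow> (real \<times> 'x \<Rightarrow> 'x) \<Rightarrow> bool" where
  "semiflow X \<Phi> \<longleftrightarrow>
     \<Phi> \<in> {0..} \<times> X \<rightarrow> X \<and>
     (\<forall>x\<in>X. \<Phi> (0, x) = x) \<and>
     (\<forall>t\<ge>0. \<forall>s\<ge>0. \<forall>x\<in>X. \<Phi> (t + s, x) = \<Phi> (s, \<Phi> (t, x)))"

definition continuous_semiflow :: "'x topology \<Rightarrow> (real \<times> 'x \<Rightarrow> 'x) \<Rightarrow> bool" where
  "continuous_semiflow X \<Phi> \<longleftrightarrow>
     semiflow (topspace X) \<Phi> \<and>
     continuous_map (prod_topology (top_of_set {0..}) X) X \<Phi>"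

end

theory Submission
  imports Defs
begin

text \<open>
  Along a solution, \<open>x(t) = \<phi>(0) + \<integral>\<^sub>0\<^sup>t f(x(s - r)) ds\<close>, the values on \<open>[0, T + r]\<close> are determined by
  those on \<open>[-r, T]\<close>. Since \<open>\<alpha> \<le> p\<close>, the growth condition gives \<open>|f(u)| \<le> A (1 + |u|\<^sup>p)\<close> for all \<open>u\<close>
  (\<open>growth_bound_global\<close>), so \<open>f\<close> maps functions with integrable \<open>p\<close>-th power to integrable functions. One delay
  at a time, this yields a unique solution (\<open>delay_flow\<close>, \<open>mild_solution_unique\<close>), which is continuous for
  nonnegative times (\<open>mild_solution_step\<close>). As the equation is autonomous, uniqueness implies
  the semiflow property (\<open>solution_of_history\<close>).

  Joint continuity splits into two parts by the triangle inequality. The first is dependence on the history,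
  uniform on compact time intervals (\<open>continuous_dependence\<close>). It rests on the continuity of
  \<open>x \<mapsto> f \<circ> x\<close> from \<open>L\<^sup>p\<close> to \<open>L\<^sup>1\<close> (\<open>nemytskii_continuous\<close>) and again proceeds one delay at a
  time: closeness in the mean on \<open>[-r, T]\<close> gives uniform closeness on \<open>[0, T + r]\<close>. The second is
  continuity in time of the segments of one fixed solution (\<open>continuous_in_time\<close>); since the initial history is
  only measurable, this is the continuity of translations in \<open>L\<^sup>p\<close> (\<open>translation_continuous\<close>).

  The norm on \<open>\<real>\<^sup>N\<close> affects neither the space of histories nor its topology
  (\<open>Lp_space_eq\<close>, \<open>openin_Lp_topology_energy\<close>), so solutions are estimated in the Euclidean norm.
\<close>

section \<open>Functions with integrable p-th power\<close>

text \<open>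
  Minkowski's inequality is replaced by the cruder \<open>|u + v|\<^sup>p \<le> 2\<^sup>p (|u|\<^sup>p + |v|\<^sup>p)\<close>. Everything below is therefore
  phrased with the integral of the \<open>p\<close>-th power itself, called energy, without taking the \<open>p\<close>-th root:
  a triangle inequality up to a constant factor describes the same topology.
\<close>

definition p_integrable :: "real \<Rightarrow> 'a measure \<Rightarrow> ('a \<Rightarrow> 'b::euclidean_space) \<Rightarrow> bool" where
  "p_integrable p M x \<longleftrightarrow> x \<in> borel_measurable M \<and> integrable M (\<lambda>s. norm (x s) powr p)"

definition p_energy :: "real \<Rightarrow> 'a measure \<Rightarrow> ('a \<Rightarrow> 'b::euclidean_space) \<Rightarrow> real" where
  "p_energy p M x = (\<integral>s. norm (x s) powr p \<partial>M)"

lemma norm_add_powr_le: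
  fixes u v :: "'a::real_normed_vector"
  assumes "0 \<le> p"
  shows "norm (u + v) powr p \<le> 2 powr p * (norm u powr p + norm v powr p)"
proof -
  have "norm (u + v) powr p \<le> (2 * max (norm u) (norm v)) powr p"
    using norm_triangle_ineq[of u v] assms by (intro powr_mono2) (auto simp: max_def)
  also have "\<dots> = 2 powr p * max (norm u) (norm v) powr p"
    by (simp add: powr_mult)
  also have "\<dots> \<le> 2 powr p * (norm u powr p + norm v powr p)"
    by (intro mult_left_mono) (auto simp: max_def)
  finally show ?thesis .
qed

lemma norm_diff_powr_le:
  fixes u v w :: "'a::real_normed_vector"
  assumes "0 \<le> p"
  shows "norm (u - w) powr p \<le> 2 powr p * (norm (u - v) powr p + norm (v - w) powr p)"
  using norm_add_powr_le[OF assms, of "u - v" "v - w"] by simp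

lemma p_energy_nonneg: "0 \<le> p_energy p M x"
  unfolding p_energy_def by (rule integral_nonneg_AE) simp

lemma p_integrable_diff:
  assumes "0 \<le> p" "p_integrable p M x" "p_integrable p M y"
  shows "p_integrable p M (\<lambda>s. x s - y s)"
proof -
  have [measurable]: "x \<in> borel_measurable M" "y \<in> borel_measurable M"
    using assms by (auto simp: p_integrable_def)
  have "integrable M (\<lambda>s. norm (x s - y s) powr p)"
  proof (rule Bochner_Integration.integrable_bound)
    show "integrable M (\<lambda>s. 2 powr p * (norm (x s) powr p + norm (y s) powr p))"
      using assms by (auto simp: p_integrable_def)
    show "AE s in M. norm (norm (x s - y s) powr p) \<le> norm (2 powr p * (norm (x s) powr p + norm (y s) powr p))"
      using norm_add_powr_le[OF assms(1), of "x s" "- y s" for s] by auto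
  qed measurable
  then show ?thesis by (simp add: p_integrable_def)
qed

lemma p_energy_triangle:
  assumes "0 \<le> p" "p_integrable p M x" "p_integrable p M y" "p_integrable p M z"
  shows "p_energy p M (\<lambda>s. x s - z s)
    \<le> 2 powr p * (p_energy p M (\<lambda>s. x s - y s) + p_energy p M (\<lambda>s. y s - z s))"
proof -
  have i: "integrable M (\<lambda>s. norm (x s - y s) powr p)" "integrable M (\<lambda>s. norm (y s - z s) powr p)"
     "integrable M (\<lambda>s. norm (x s - z s) powr p)"
    using p_integrable_diff assms unfolding p_integrable_def by blast+
  have "p_energy p M (\<lambda>s. x s - z s)
    \<le> (\<integral>s. 2 powr p * (norm (x s - y s) powr p + norm (y s - z s) powr p) \<partial>M)"
    unfolding p_energy_def using i by (intro integral_mono) (auto intro!: norm_diff_powr_le assms)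
  also have "\<dots> = 2 powr p * (p_energy p M (\<lambda>s. x s - y s) + p_energy p M (\<lambda>s. y s - z s))"
    unfolding p_energy_def using i by simp
  finally show ?thesis .
qed

section \<open>Continuity of the superposition operator\<close>

lemma integrable_compose_growth:
  fixes f :: "'b::euclidean_space \<Rightarrow> 'c::euclidean_space"
  assumes "finite_measure M" and f: "continuous_on UNIV f"
    and A: "\<And>u. norm (f u) \<le> A * (1 + norm u powr p)"
    and x: "p_integrable p M x"
  shows "integrable M (\<lambda>s. f (x s))"
proof (rule Bochner_Integration.integrable_bound)
  interpret finite_measure M by fact
  have [measurable]: "x \<in> borel_measurable M" "f \<in> borel_measurable borel"
    using x f by (auto simp: p_integrable_def borel_measurable_continuous_onI)
  show "integrable M (\<lambda>s. A * (1 + norm (x s) powr p))"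
    using x by (auto simp: p_integrable_def)
  show "(\<lambda>s. f (x s)) \<in> borel_measurable M" by measurable
  show "AE s in M. norm (f (x s)) \<le> norm (A * (1 + norm (x s) powr p))"
    using A by (auto intro: order_trans abs_ge_self)
qed

text \<open>
  The part of the increment of \<open>f\<close> at \<open>u\<close> that is not controlled by \<open>m |v|\<^sup>p\<close>. It depends on the base point
  \<open>u\<close> only, so that its integral along \<open>x\<close> is small uniformly in the perturbation of \<open>x\<close>.
\<close>

definition excess :: "real \<Rightarrow> ('b::euclidean_space \<Rightarrow> 'c::euclidean_space) \<Rightarrow> real \<Rightarrow> 'b \<Rightarrow> real" where
  "excess p f m u = (SUP v. norm (f (u + v) - f u) - m * norm v powr p)"

lemma increment_growth:
  fixes f :: "'b::euclidean_space \<Rightarrow> 'c::euclidean_space"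
  assumes "0 \<le> p" and A: "\<And>u. norm (f u) \<le> A * (1 + norm u powr p)"
  shows "norm (f (u + v) - f u)
    \<le> A * (2 + (2 powr p + 1) * norm u powr p) + A * 2 powr p * norm v powr p"
proof -
  have "0 \<le> A" using order_trans[OF norm_ge_zero A[of 0]] by (simp add: zero_le_mult_iff)
  have "norm (f (u + v) - f u) \<le> A * (1 + norm (u + v) powr p) + A * (1 + norm u powr p)"
    using A[of "u + v"] A[of u] norm_triangle_ineq4[of "f (u+v)" "f u"] by linarith
  also have "\<dots> \<le> A * (1 + 2 powr p * (norm u powr p + norm v powr p)) + A * (1 + norm u powr p)"
    using norm_add_powr_le[OF assms(1)] \<open>0 \<le> A\<close> by (intro add_mono mult_left_mono) auto
  finally show ?thesis by (simp add: algebra_simps)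
qed

text \<open>
  By definition of the excess, \<open>|f(y) - f(x)| \<le> excess p f m x + m |y - x|\<^sup>p\<close> pointwise. For large \<open>m\<close> the growth
  bound on \<open>f\<close> dominates the excess by a multiple of \<open>1 + |u|\<^sup>p\<close>, and continuity of \<open>f\<close> makes it tend to
  \<open>0\<close> at every point as \<open>m \<rightarrow> \<infinity>\<close>: small increments \<open>v\<close> change \<open>f\<close> little, and for the others \<open>|v|\<^sup>p\<close> is
  bounded below. Dominated convergence thus provides an \<open>m\<close> for which the first term has integral
  below \<open>e/2\<close>; after that \<open>d = e/(2m)\<close> takes care of the second term.
\<close>

lemma nemytskii_continuous:
  fixes f :: "'b::euclidean_space \<Rightarrow> 'c::euclidean_space"
  assumes M: "finite_measure M" and p: "0 < p" and f: "continuous_on UNIV f"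
    and A: "\<And>u. norm (f u) \<le> A * (1 + norm u powr p)"
    and x: "p_integrable p M x" and e: "0 < e"
  obtains d where "0 < d"
    "\<And>y. p_integrable p M y \<Longrightarrow> p_energy p M (\<lambda>s. y s - x s) < d \<Longrightarrow>
       (\<integral>s. norm (f (y s) - f (x s)) \<partial>M) < e"
proof -
  interpret finite_measure M by fact
  \<comment> \<open>\<open>A * 2 powr p\<close> is the coefficient of \<open>|v|\<^sup>p\<close> in the growth bound of the increment; the 1 makes \<open>m\<close> positive\<close>
  define m where "m n = A * 2 powr p + 1 + real n" for n
  define B where "B u = A * (2 + (2 powr p + 1) * norm u powr p)" for u :: 'b
  have "0 \<le> A" using order_trans[OF norm_ge_zero A[of 0]] by (simp add: zero_le_mult_iff)
  have m_pos: "0 < m n" for n using mult_nonneg_nonneg[OF \<open>0 \<le> A\<close>, of "2 powr p"] by (simp add: m_def add.assoc add_nonneg_pos)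
  have B_nonneg: "0 \<le> B u" for u using \<open>0 \<le> A\<close> by (simp add: B_def)
  have inc: "norm (f (u + v) - f u) \<le> B u + (m n - 1 - real n) * norm v powr p" for u v n
    using increment_growth[where p=p and f=f and A=A and u=u and v=v] p A by (simp add: B_def m_def)
  have le_B: "norm (f (u + v) - f u) - m n * norm v powr p \<le> B u" for u v n
  proof -
    have "(m n - 1 - real n) * norm v powr p \<le> m n * norm v powr p"
      by (intro mult_right_mono) auto
    then show ?thesis using inc[of u v n] by linarith
  qed
  have bdd: "bdd_above (range (\<lambda>v. norm (f (u + v) - f u) - m n * norm v powr p))" for u n
    using le_B by (intro bdd_aboveI[of _ "B u"]) auto
  have ub: "norm (f (u + v) - f u) - m n * norm v powr p \<le> excess p f (m n) u" for u v n
    unfolding excess_def using bdd by (rule cSUP_upper[OF UNIV_I])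
  have ex_nonneg: "0 \<le> excess p f (m n) u" for u n
    using ub[of u 0 n] p by simp
  have ex_le: "excess p f (m n) u \<le> B u" for u n
    unfolding excess_def by (rule cSUP_least) (auto simp: le_B)
  have fb[measurable]: "f \<in> borel_measurable borel"
    using f by (simp add: borel_measurable_continuous_onI)
  have xb[measurable]: "x \<in> borel_measurable M" using x by (simp add: p_integrable_def)
  \<comment> \<open>a supremum of continuous functions has open superlevel sets\<close>
  have ex_borel[measurable]: "excess p f (m n) \<in> borel_measurable borel" for n
  proof (subst borel_measurable_iff_greater, intro allI)
    fix c
    have "{u. c < excess p f (m n) u}
        = (\<Union>v. {u. c < norm (f (u + v) - f u) - m n * norm v powr p})"
      unfolding excess_def using less_cSUP_iff[OF _ bdd] by auto
    moreover have "open \<dots>"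
    proof (intro open_UN ballI open_Collect_less)
      fix v
      show "continuous_on UNIV (\<lambda>u. norm (f (u + v) - f u) - m n * norm v powr p)"
        by (intro continuous_intros continuous_on_compose2[OF f]) auto
    qed (auto intro!: continuous_intros)
    ultimately show "{u \<in> space borel. c < excess p f (m n) u} \<in> sets borel" by simp
  qed
  have ex_lim: "(\<lambda>n. excess p f (m n) u) \<longlonglongrightarrow> 0" for u
  proof (rule LIMSEQ_I)
    fix r :: real assume "0 < r"
    have "isCont f u" using f by (simp add: continuous_on_eq_continuous_at)
    then obtain d where d: "0 < d" "\<And>w. dist w u < d \<Longrightarrow> dist (f w) (f u) < r / 2"
      using \<open>0 < r\<close> unfolding continuous_at_eps_delta by (metis half_gt_zero)
    obtain N :: nat where N: "B u / d powr p < real N" using reals_Archimedean2 by blast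
    have "norm (excess p f (m n) u - 0) < r" if "N \<le> n" for n
    proof -
      have "excess p f (m n) u \<le> r / 2"
        unfolding excess_def
      proof (rule cSUP_least)
        fix v
        show "norm (f (u + v) - f u) - m n * norm v powr p \<le> r / 2"
        proof (cases "norm v < d")
          case True
          then have "norm (f (u + v) - f u) < r / 2" using d(2)[of "u + v"] by (simp add: dist_norm)
          moreover have "0 \<le> m n * norm v powr p" using m_pos[of n] by simp
          ultimately show ?thesis by linarith
        next
          case False
          have "B u \<le> real N * d powr p" using N d(1) by (simp add: field_simps)
          also have "\<dots> \<le> (1 + real n) * norm v powr p"
            using False d(1) p that by (intro mult_mono powr_mono2) auto
          finally have "B u \<le> (1 + real n) * norm v powr p" .
          then have "norm (f (u + v) - f u) \<le> m n * norm v powr p"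
            using inc[of u v n] by (simp add: algebra_simps)
          then show ?thesis using \<open>0 < r\<close> by simp
        qed
      qed simp
      then show ?thesis using ex_nonneg[of n u] \<open>0 < r\<close> by simp
    qed
    then show "\<exists>no. \<forall>n\<ge>no. norm (excess p f (m n) u - 0) < r" by blast
  qed
  have intB: "integrable M (\<lambda>s. B (x s))"
    unfolding B_def using x by (auto simp: p_integrable_def)
  have "(\<lambda>n. \<integral>s. excess p f (m n) (x s) \<partial>M) \<longlonglongrightarrow> (\<integral>s. 0 \<partial>M)"
    by (rule integral_dominated_convergence[where w="\<lambda>s. B (x s)"])
       (use intB ex_le ex_nonneg ex_lim in auto)
  then obtain n where n: "(\<integral>s. excess p f (m n) (x s) \<partial>M) < e / 2"
    using order_tendstoD(2)[of _ _ sequentially "e / 2"] e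
    by (fastforce simp: eventually_sequentially)
  have ex_int: "integrable M (\<lambda>s. excess p f (m n) (x s))"
    by (rule Bochner_Integration.integrable_bound[OF intB])
       (use ex_le ex_nonneg B_nonneg in auto)
  show ?thesis
  proof (rule that[of "e / (2 * m n)"])
    show "0 < e / (2 * m n)" using e m_pos by simp
    fix y assume y: "p_integrable p M y" and small: "p_energy p M (\<lambda>s. y s - x s) < e / (2 * m n)"
    have yx: "integrable M (\<lambda>s. norm (y s - x s) powr p)"
      using p_integrable_diff[OF _ y x] p by (simp add: p_integrable_def)
    have "(\<integral>s. norm (f (y s) - f (x s)) \<partial>M)
        \<le> (\<integral>s. excess p f (m n) (x s) + m n * norm (y s - x s) powr p \<partial>M)"
    proof (rule integral_mono)
      show "integrable M (\<lambda>s. norm (f (y s) - f (x s)))"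
        using integrable_compose_growth[OF M f A] x y by auto
      show "integrable M (\<lambda>s. excess p f (m n) (x s) + m n * norm (y s - x s) powr p)"
        using ex_int yx by auto
      show "norm (f (y s) - f (x s)) \<le> excess p f (m n) (x s) + m n * norm (y s - x s) powr p" for s
        using ub[of "x s" "y s - x s" n] by simp
    qed
    also have "\<dots> = (\<integral>s. excess p f (m n) (x s) \<partial>M) + m n * p_energy p M (\<lambda>s. y s - x s)"
      unfolding p_energy_def using ex_int yx by simp
    also have "\<dots> < e / 2 + m n * (e / (2 * m n))"
      using n small m_pos[of n] by (intro add_strict_mono mult_strict_left_mono)
    also have "\<dots> = e" using m_pos[of n] by simp
    finally show "(\<integral>s. norm (f (y s) - f (x s)) \<partial>M) < e" .
  qed
qed

section \<open>Intervals, translations, and continuous approximation\<close>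

lemma measurable_shift_Icc:
  fixes a b c :: real
  shows "(\<lambda>s. s + c) \<in> lebesgue_on {a..b} \<rightarrow>\<^sub>M lebesgue_on {a + c..b + c}"
  using lebesgue_affine_measurable[where c="\<lambda>_::real. 1" and t=c]
  by (intro measurable_restrict_space3) (auto simp: add.commute)

lemma has_bochner_integral_shift_Icc:
  fixes g :: "real \<Rightarrow> 'b::euclidean_space"
  shows "has_bochner_integral (lebesgue_on {a..b}) (\<lambda>s. g (s + c)) i
     \<longleftrightarrow> has_bochner_integral (lebesgue_on {a + c..b + c}) g i"
proof -
  have "indicat_real {a + c..b + c} (c + 1 * s) *\<^sub>R g (c + 1 * s) = indicat_real {a..b} s *\<^sub>R g (s + c)" for s
    by (auto simp: indicator_def add.commute)
  then show ?thesis
    using has_bochner_integral_lebesgue_real_affine_iff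
      [of 1 "\<lambda>s. indicator {a + c..b + c} s *\<^sub>R g s" i c]
    by (simp add: has_bochner_integral_restrict_space)
qed

lemma integrable_shift_Icc:
  fixes g :: "real \<Rightarrow> 'b::euclidean_space"
  shows "integrable (lebesgue_on {a..b}) (\<lambda>s. g (s + c)) \<longleftrightarrow> integrable (lebesgue_on {a + c..b + c}) g"
  using has_bochner_integral_shift_Icc[of a b g c] unfolding integrable.simps by blast

lemma integral_shift_Icc:
  fixes g :: "real \<Rightarrow> 'b::euclidean_space"
  shows "(\<integral>s. g (s + c) \<partial>lebesgue_on {a..b}) = (\<integral>s. g s \<partial>lebesgue_on {a + c..b + c})"
  using has_bochner_integral_shift_Icc[of a b g c]
  by (metis has_bochner_integral_iff integrable_shift_Icc not_integrable_integral_eq)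

lemma p_integrable_shift:
  fixes x :: "real \<Rightarrow> 'b::euclidean_space"
  assumes "p_integrable p (lebesgue_on {a + c..b + c}) x"
  shows "p_integrable p (lebesgue_on {a..b}) (\<lambda>s. x (s + c))"
  using assms measurable_compose[OF measurable_shift_Icc[of c a b], of x borel]
    integrable_shift_Icc[of a b "\<lambda>s. norm (x s) powr p" c]
  by (simp add: p_integrable_def)

lemma p_energy_shift:
  fixes x :: "real \<Rightarrow> 'b::euclidean_space"
  shows "p_energy p (lebesgue_on {a..b}) (\<lambda>s. x (s + c)) = p_energy p (lebesgue_on {a + c..b + c}) x"
  unfolding p_energy_def by (rule integral_shift_Icc[where g="\<lambda>s. norm (x s) powr p"])

lemma p_integrable_subinterval:
  fixes x :: "real \<Rightarrow> 'b::euclidean_space"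
  assumes "p_integrable p (lebesgue_on {a..b}) x" "{c..d} \<subseteq> {a..b}"
  shows "p_integrable p (lebesgue_on {c..d}) x"
  using assms measurable_restrict_mono integrable_subinterval unfolding p_integrable_def by blast

lemma p_energy_mono_interval:
  fixes x :: "real \<Rightarrow> 'b::euclidean_space"
  assumes "p_integrable p (lebesgue_on {a..b}) x" "{c..d} \<subseteq> {a..b}"
  shows "p_energy p (lebesgue_on {c..d}) x \<le> p_energy p (lebesgue_on {a..b}) x"
  unfolding p_energy_def using assms
  by (intro integral_mono_lebesgue_on_AE) (auto simp: p_integrable_def)

lemma p_integrable_combine:
  fixes x :: "real \<Rightarrow> 'b::euclidean_space"
  assumes "p_integrable p (lebesgue_on {a..c}) x" "p_integrable p (lebesgue_on {c..b}) x"
    and "a \<le> c" "c \<le> b"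
  shows "p_integrable p (lebesgue_on {a..b}) x"
proof -
  have "x \<in> borel_measurable (lebesgue_on {a..b})"
  proof (rule borel_measurable_if_D)
    have m: "(\<lambda>s. if s \<in> {a..c} then x s else 0) \<in> borel_measurable lebesgue"
      "(\<lambda>s. if s \<in> {c..b} then x s else 0) \<in> borel_measurable lebesgue"
      using assms by (auto simp: p_integrable_def simp del: atLeastAtMost_iff intro!: borel_measurable_if_I)
    have "(\<lambda>s. if s \<in> {a..c} then (if s \<in> {a..c} then x s else 0)
          else (if s \<in> {c..b} then x s else 0)) \<in> borel_measurable lebesgue"
      by (rule measurable_If_set[OF m]) auto
    also have "(\<lambda>s. if s \<in> {a..c} then (if s \<in> {a..c} then x s else 0)
          else (if s \<in> {c..b} then x s else 0)) = (\<lambda>s. if s \<in> {a..b} then x s else 0)"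
      using assms(3,4) by (auto simp: fun_eq_iff)
    finally show "(\<lambda>s. if s \<in> {a..b} then x s else 0) \<in> borel_measurable lebesgue" .
  qed
  then show ?thesis
    using assms integrable_combine[of a c "\<lambda>s. norm (x s) powr p" b] by (simp add: p_integrable_def)
qed

lemma p_energy_combine:
  fixes x :: "real \<Rightarrow> 'b::euclidean_space"
  assumes "p_integrable p (lebesgue_on {a..b}) x" "a \<le> c" "c \<le> b"
  shows "p_energy p (lebesgue_on {a..b}) x
       = p_energy p (lebesgue_on {a..c}) x + p_energy p (lebesgue_on {c..b}) x"
  unfolding p_energy_def using assms by (intro integral_combine) (auto simp: p_integrable_def)

lemma p_integrable_continuous:
  fixes x :: "real \<Rightarrow> 'b::euclidean_space"
  assumes "continuous_on {a..b} x" "0 < p"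
  shows "p_integrable p (lebesgue_on {a..b}) x"
  unfolding p_integrable_def
proof
  show "x \<in> borel_measurable (lebesgue_on {a..b})"
    using assms by (intro continuous_imp_measurable_on_sets_lebesgue) auto
  show "integrable (lebesgue_on {a..b}) (\<lambda>s. norm (x s) powr p)"
    using assms by (intro continuous_imp_integrable_real continuous_on_powr' continuous_intros) auto
qed

lemma p_energy_le_bound:
  fixes x :: "real \<Rightarrow> 'b::euclidean_space"
  assumes "p_integrable p (lebesgue_on {a..b}) x" "0 \<le> p" "a \<le> b"
    and "\<And>s. s \<in> {a..b} \<Longrightarrow> norm (x s) \<le> c"
  shows "p_energy p (lebesgue_on {a..b}) x \<le> (b - a) * c powr p"
proof -
  interpret finite_measure "lebesgue_on {a..b}" by (rule finite_measure_lebesgue_on) simp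
  have "p_energy p (lebesgue_on {a..b}) x \<le> (\<integral>s. c powr p \<partial>lebesgue_on {a..b})"
    unfolding p_energy_def using assms
    by (intro integral_mono) (auto simp: p_integrable_def intro!: powr_mono2)
  also have "\<dots> = (b - a) * c powr p"
    using assms(3) by (simp add: measure_restrict_space)
  finally show ?thesis .
qed

lemma p_energy_minus_commute:
  "p_energy p M (\<lambda>s. x s - y s) = p_energy p M (\<lambda>s. y s - x s)"
  by (simp add: p_energy_def norm_minus_commute)

text \<open>
  A measurable function is an almost everywhere limit of continuous functions \<open>h k\<close>. To turn this
  into convergence of the energy, values are first projected onto a large ball: the projection
  changes \<open>x\<close> little, and after it dominated convergence applies with a constant bound. Since the projection
  is continuous, so are the approximants.
\<close>

lemma p_integrable_approx_continuous:
  fixes x :: "real \<Rightarrow> 'b::euclidean_space"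
  assumes x: "p_integrable p (lebesgue_on {a..b}) x" and p: "0 < p" and e: "0 < e"
  obtains g where "continuous_on UNIV g" "p_energy p (lebesgue_on {a..b}) (\<lambda>s. x s - g s) < e"
proof -
  let ?M = "lebesgue_on {a..b}"
  interpret finite_measure ?M by (rule finite_measure_lebesgue_on) simp
  define clamp :: "nat \<Rightarrow> 'b \<Rightarrow> 'b" where "clamp n = closest_point (cball 0 (real n))" for n
  have clamp_cont: "continuous_on UNIV (clamp n)" for n
    unfolding clamp_def by (rule continuous_on_closest_point) auto
  have clamp_borel[measurable]: "clamp n \<in> borel_measurable borel" for n
    using clamp_cont by (rule borel_measurable_continuous_onI)
  have clamp_bound: "norm (clamp n v) \<le> real n" for n v
    using closest_point_in_set[of "cball (0::'b) (real n)" v] by (simp add: clamp_def)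
  have clamp_id: "clamp n v = v" if "norm v \<le> real n" for n v
    using that by (simp add: clamp_def closest_point_self)
  have clamp_dist: "norm (v - clamp n v) \<le> norm v" for n v
    using closest_point_le[of "cball (0::'b) (real n)" 0 v] by (simp add: clamp_def dist_norm)
  have [measurable]: "x \<in> borel_measurable ?M" using x by (simp add: p_integrable_def)
  define e' where "e' = e / (2 * 2 powr p)"
  have e': "0 < e'" using e by (simp add: e'_def)
  have "(\<lambda>n. \<integral>s. norm (x s - clamp n (x s)) powr p \<partial>?M) \<longlonglongrightarrow> (\<integral>s. 0 \<partial>?M)"
  proof (rule integral_dominated_convergence[where w="\<lambda>s. norm (x s) powr p"])
    show "AE s in ?M. (\<lambda>n. norm (x s - clamp n (x s)) powr p) \<longlonglongrightarrow> 0"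
    proof (rule AE_I2, rule tendsto_eventually)
      fix s
      obtain N :: nat where "norm (x s) \<le> real N" using real_arch_simple by blast
      then show "\<forall>\<^sub>F n in sequentially. norm (x s - clamp n (x s)) powr p = 0"
        using clamp_id[of "x s"] by (auto simp: eventually_sequentially intro!: exI[of _ N])
    qed
    show "integrable ?M (\<lambda>s. norm (x s) powr p)" using x by (simp add: p_integrable_def)
    show "AE s in ?M. norm (norm (x s - clamp n (x s)) powr p) \<le> norm (x s) powr p" for n
      using clamp_dist p by (auto intro!: powr_mono2)
  qed measurable
  then obtain n where n: "p_energy p ?M (\<lambda>s. x s - clamp n (x s)) < e'"
    using order_tendstoD(2)[of _ _ sequentially e'] e' unfolding p_energy_def
    by (fastforce simp: eventually_sequentially)
  have "x measurable_on {a..b}" by (simp add: measurable_on_iff_borel_measurable)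
  then obtain N h where N: "negligible N" and h: "\<And>k. continuous_on UNIV (h k)"
    and lim: "\<And>s. s \<notin> N \<Longrightarrow> (\<lambda>k. h k s) \<longlonglongrightarrow> (if s \<in> {a..b} then x s else 0)"
    unfolding measurable_on_def by blast
  have h_meas[measurable]: "h k \<in> borel_measurable ?M" for k
    by (rule continuous_imp_measurable_on_sets_lebesgue[OF continuous_on_subset[OF h]]) auto
  have ae: "AE s in ?M. s \<notin> N"
    using N by (auto simp: AE_restrict_space_iff negligible_iff_null_sets AE_not_in
        intro: eventually_mono[OF AE_not_in])
  have cint: "p_integrable p ?M (\<lambda>s. clamp n (y s))" if [measurable]: "y \<in> borel_measurable ?M" for y
    unfolding p_integrable_def
  proof
    show "(\<lambda>s. clamp n (y s)) \<in> borel_measurable ?M" by measurable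
    show "integrable ?M (\<lambda>s. norm (clamp n (y s)) powr p)"
      by (rule integrable_const_bound[where B="real n powr p"])
         (use clamp_bound p in \<open>auto intro!: powr_mono2\<close>)
  qed
  have "(\<lambda>k. \<integral>s. norm (clamp n (x s) - clamp n (h k s)) powr p \<partial>?M) \<longlonglongrightarrow> (\<integral>s. 0 \<partial>?M)"
  proof (rule integral_dominated_convergence[where w="\<lambda>s. (2 * real n) powr p"])
    show "AE s in ?M. (\<lambda>k. norm (clamp n (x s) - clamp n (h k s)) powr p) \<longlonglongrightarrow> 0"
    proof (rule AE_mp[OF ae], rule AE_I2, rule impI)
      fix s assume s: "s \<in> space ?M" "s \<notin> N"
      then have "(\<lambda>k. h k s) \<longlonglongrightarrow> x s" using lim[of s] by simp
      then have "(\<lambda>k. clamp n (h k s)) \<longlonglongrightarrow> clamp n (x s)"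
        using clamp_cont[of n] by (metis continuous_on_eq_continuous_at isCont_tendsto_compose open_UNIV UNIV_I)
      then have "(\<lambda>k. norm (clamp n (x s) - clamp n (h k s))) \<longlonglongrightarrow> norm (clamp n (x s) - clamp n (x s))"
        by (intro tendsto_intros)
      then show "(\<lambda>k. norm (clamp n (x s) - clamp n (h k s)) powr p) \<longlonglongrightarrow> 0"
        using p tendsto_powr'[of _ 0 sequentially "\<lambda>_. p" p] by (simp add: tendsto_powr)
    qed
    show "AE s in ?M. norm (norm (clamp n (x s) - clamp n (h k s)) powr p) \<le> (2 * real n) powr p" for k
    proof (rule AE_I2)
      fix s
      have "norm (clamp n (x s) - clamp n (h k s)) \<le> 2 * real n"
        using clamp_bound[of n "x s"] clamp_bound[of n "h k s"]
          norm_triangle_ineq4[of "clamp n (x s)" "clamp n (h k s)"] by linarith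
      then show "norm (norm (clamp n (x s) - clamp n (h k s)) powr p) \<le> (2 * real n) powr p"
        using p by (auto intro!: powr_mono2)
    qed
  qed auto
  then obtain k where k: "p_energy p ?M (\<lambda>s. clamp n (x s) - clamp n (h k s)) < e'"
    using order_tendstoD(2)[of _ _ sequentially e'] e' unfolding p_energy_def
    by (fastforce simp: eventually_sequentially)
  show ?thesis
  proof (rule that[of "\<lambda>s. clamp n (h k s)"])
    show "continuous_on UNIV (\<lambda>s. clamp n (h k s))"
      by (rule continuous_on_compose2[OF clamp_cont h]) auto
    have "p_energy p ?M (\<lambda>s. x s - clamp n (h k s)) \<le> 2 powr p *
      (p_energy p ?M (\<lambda>s. x s - clamp n (x s)) + p_energy p ?M (\<lambda>s. clamp n (x s) - clamp n (h k s)))"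
      using p x by (intro p_energy_triangle cint) auto
    also have "\<dots> < 2 powr p * (e' + e')" using n k by (intro mult_strict_left_mono) auto
    also have "\<dots> = e" by (simp add: e'_def)
    finally show "p_energy p ?M (\<lambda>s. x s - clamp n (h k s)) < e" .
  qed
qed

text \<open>
  The shifts of \<open>x\<close> are compared with the shifts of a continuous approximant, which is uniformly
  continuous on the compact interval.
\<close>

lemma translation_continuous:
  fixes x :: "real \<Rightarrow> 'b::euclidean_space"
  assumes x: "p_integrable p (lebesgue_on {a..b}) x" and p: "0 < p" and e: "0 < e" and ab: "a \<le> b"
  obtains d where "0 < d"
    "\<And>l u c c'. \<lbrakk>l \<le> u; {l + c..u + c} \<subseteq> {a..b}; {l + c'..u + c'} \<subseteq> {a..b}; \<bar>c - c'\<bar> < d\<rbrakk>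
       \<Longrightarrow> p_energy p (lebesgue_on {l..u}) (\<lambda>s. x (s + c) - x (s + c')) < e"
proof -
  define K where "K = (2::real) powr p"
  have K: "1 \<le> K" using p by (simp add: K_def ge_one_powr_ge_zero)
  \<comment> \<open>two applications of the triangle inequality with factor \<open>K\<close> give at most \<open>3 * K\<^sup>2 * \<eta>\<close>\<close>
  define \<eta> where "\<eta> = e / (4 * K * K)"
  have \<eta>: "0 < \<eta>" using e K by (simp add: \<eta>_def)
  obtain g where g: "continuous_on UNIV g" and gx: "p_energy p (lebesgue_on {a..b}) (\<lambda>s. x s - g s) < \<eta>"
    using p_integrable_approx_continuous[OF x p \<eta>] by blast
  \<comment> \<open>an error of at most \<open>\<omega>\<close> throughout an interval of length at most \<open>b - a\<close> has energy at most \<open>\<eta>\<close>\<close>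
  define \<omega> where "\<omega> = (\<eta> / (b - a + 1)) powr (1 / p)"
  have \<omega>: "0 < \<omega>" "\<omega> powr p = \<eta> / (b - a + 1)"
    using \<eta> ab p by (auto simp: \<omega>_def powr_powr)
  have "uniformly_continuous_on {a..b} g"
    by (intro compact_uniformly_continuous continuous_on_subset[OF g]) auto
  then obtain d where d: "0 < d"
    "\<And>s t. s \<in> {a..b} \<Longrightarrow> t \<in> {a..b} \<Longrightarrow> dist t s < d \<Longrightarrow> dist (g t) (g s) < \<omega>"
    using \<omega>(1) unfolding uniformly_continuous_on_def by metis
  show ?thesis
  proof (rule that[OF d(1)])
    fix l u c c' :: real
    assume lu: "l \<le> u" and c: "{l + c..u + c} \<subseteq> {a..b}" and c': "{l + c'..u + c'} \<subseteq> {a..b}"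
      and close: "\<bar>c - c'\<bar> < d"
    let ?M = "lebesgue_on {l..u}"
    have gi: "p_integrable p (lebesgue_on {a..b}) g"
      using p by (intro p_integrable_continuous continuous_on_subset[OF g]) auto
    have xc: "p_integrable p ?M (\<lambda>s. x (s + c))" "p_integrable p ?M (\<lambda>s. x (s + c'))"
      and gc: "p_integrable p ?M (\<lambda>s. g (s + c))" "p_integrable p ?M (\<lambda>s. g (s + c'))"
      using x gi c c' by (blast intro: p_integrable_shift p_integrable_subinterval)+
    have xg: "p_integrable p (lebesgue_on {a..b}) (\<lambda>s. x s - g s)"
      using p_integrable_diff[OF _ x gi] p by simp
    have 1: "p_energy p ?M (\<lambda>s. x (s + c) - g (s + c)) < \<eta>"
      using p_energy_shift[of p l u "\<lambda>s. x s - g s" c] p_energy_mono_interval[OF xg c] gx by simp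
    have 3: "p_energy p ?M (\<lambda>s. g (s + c') - x (s + c')) < \<eta>"
      using p_energy_shift[of p l u "\<lambda>s. x s - g s" c'] p_energy_mono_interval[OF xg c'] gx
      by (simp add: p_energy_minus_commute[of p _ "\<lambda>s. g (s + c')"])
    have "p_energy p ?M (\<lambda>s. g (s + c) - g (s + c')) \<le> (u - l) * \<omega> powr p"
    proof (rule p_energy_le_bound[OF p_integrable_diff[OF _ gc] _ lu])
      fix s assume s: "s \<in> {l..u}"
      then have "s + c \<in> {a..b}" "s + c' \<in> {a..b}" using c c' by auto
      then show "norm (g (s + c) - g (s + c')) \<le> \<omega>"
        using d(2)[of "s + c'" "s + c"] close by (simp add: dist_norm)
    qed (use p in auto)
    also have "\<dots> \<le> (b - a + 1) * \<omega> powr p"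
      using c lu by (intro mult_right_mono) auto
    also have "\<dots> = \<eta>" using \<omega>(2) ab by simp
    finally have 2: "p_energy p ?M (\<lambda>s. g (s + c) - g (s + c')) \<le> \<eta>" .
    have "p_energy p ?M (\<lambda>s. x (s + c) - x (s + c'))
      \<le> K * (p_energy p ?M (\<lambda>s. x (s + c) - g (s + c)) + p_energy p ?M (\<lambda>s. g (s + c) - x (s + c')))"
      unfolding K_def using p by (intro p_energy_triangle xc gc) auto
    also have "\<dots> \<le> K * (p_energy p ?M (\<lambda>s. x (s + c) - g (s + c)) +
      K * (p_energy p ?M (\<lambda>s. g (s + c) - g (s + c')) + p_energy p ?M (\<lambda>s. g (s + c') - x (s + c'))))"
      unfolding K_def using p by (intro mult_left_mono add_left_mono p_energy_triangle xc gc) auto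
    also have "\<dots> \<le> K * (\<eta> + K * (\<eta> + \<eta>))"
      using 1 2 3 K by (intro mult_left_mono add_mono) auto
    also have "\<dots> \<le> K * (K * \<eta> + K * (\<eta> + \<eta>))"
      using K \<eta> by (intro mult_left_mono add_right_mono) auto
    also have "\<dots> < e" using K e by (simp add: \<eta>_def field_simps)
    finally show "p_energy p ?M (\<lambda>s. x (s + c) - x (s + c')) < e" .
  qed
qed

section \<open>The topology of the space of histories\<close>

lemma is_norm_nonneg:
  assumes "is_norm nrm"
  shows "0 \<le> nrm x"
proof -
  have zero: "nrm y = 0 \<longleftrightarrow> y = 0" and scale: "nrm (a *\<^sub>R y) = \<bar>a\<bar> * nrm y"
    and tri: "nrm (y + z) \<le> nrm y + nrm z" for y z a
    using assms by (auto simp: is_norm_def)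
  have "0 \<le> nrm x + nrm (- x)" using tri[of x "- x"] zero[of 0] by simp
  moreover have "nrm (- x) = nrm x" using scale[of "-1" x] by simp
  ultimately show ?thesis by simp
qed

lemma is_norm_equivalent:
  fixes nrm :: "'a::euclidean_space \<Rightarrow> real"
  assumes nrm: "is_norm nrm"
  obtains c C where "0 < c" "0 < C" "\<And>x. c * norm x \<le> nrm x" "\<And>x. nrm x \<le> C * norm x"
    "continuous_on UNIV nrm"
proof -
  have zero: "nrm x = 0 \<longleftrightarrow> x = 0" and scale: "nrm (a *\<^sub>R x) = \<bar>a\<bar> * nrm x"
    and tri: "nrm (x + y) \<le> nrm x + nrm y" for x y a
    using nrm by (auto simp: is_norm_def)
  have sum: "nrm (sum g I) \<le> (\<Sum>i\<in>I. nrm (g i))" if "finite I" for g :: "'a \<Rightarrow> 'a" and I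
    using that
  proof induction
    case (insert i I)
    then show ?case using tri[of "g i" "sum g I"] by simp
  qed (use zero[of 0] in simp)
  define C where "C = (\<Sum>b\<in>Basis. nrm (b::'a)) + 1"
  have C: "0 < C" using is_norm_nonneg[OF nrm] by (auto simp: C_def intro!: add_nonneg_pos sum_nonneg)
  have up: "nrm x \<le> C * norm x" for x
  proof -
    have "nrm x \<le> (\<Sum>b\<in>Basis. nrm ((x \<bullet> b) *\<^sub>R b))"
      using sum[of Basis "\<lambda>b. (x \<bullet> b) *\<^sub>R b"] by (simp add: euclidean_representation)
    also have "\<dots> \<le> (\<Sum>b\<in>Basis. norm x * nrm b)"
      unfolding scale by (intro sum_mono mult_right_mono Basis_le_norm is_norm_nonneg[OF nrm])
    also have "\<dots> \<le> C * norm x" by (simp add: C_def sum_distrib_left[symmetric] algebra_simps)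
    finally show ?thesis .
  qed
  have lip: "\<bar>nrm x - nrm y\<bar> \<le> C * norm (x - y)" for x y
  proof -
    have "nrm x \<le> nrm (x - y) + nrm y" "nrm y \<le> nrm (y - x) + nrm x"
      using tri[of "x - y" y] tri[of "y - x" x] by simp_all
    then show ?thesis using up[of "x - y"] up[of "y - x"] by (simp add: norm_minus_commute)
  qed
  have cont: "continuous_on UNIV nrm"
    unfolding continuous_on_iff
  proof (intro ballI allI impI)
    fix x and e :: real assume "0 < e"
    show "\<exists>d>0. \<forall>y\<in>UNIV. dist y x < d \<longrightarrow> dist (nrm y) (nrm x) < e"
    proof (intro exI[of _ "e / C"] conjI ballI impI)
      fix y assume "dist y x < e / C"
      then show "dist (nrm y) (nrm x) < e"
        using lip[of y x] C by (simp add: dist_norm field_simps)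
    qed (use \<open>0 < e\<close> C in simp)
  qed
  obtain z where z: "z \<in> sphere (0::'a) 1" "\<And>y. y \<in> sphere 0 1 \<Longrightarrow> nrm z \<le> nrm y"
    using continuous_attains_inf[of "sphere (0::'a) 1" nrm] continuous_on_subset[OF cont] by auto
  have "0 < nrm z" using z(1) zero[of z] is_norm_nonneg[OF nrm, of z] by fastforce
  moreover have "nrm z * norm x \<le> nrm x" for x
  proof (cases "x = 0")
    case False
    then have "nrm z \<le> nrm ((1 / norm x) *\<^sub>R x)" by (intro z(2)) simp
    then show ?thesis using False by (simp add: scale field_simps)
  qed (use zero[of 0] in simp)
  ultimately show ?thesis using that[OF _ C _ up cont] by blast
qed

text \<open>
  The \<open>p\<close>-th power of the seminorm, taken for the Euclidean norm.
\<close>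

definition history_energy :: "real \<Rightarrow> real \<Rightarrow> (real \<Rightarrow> 'b::euclidean_space) \<Rightarrow> real" where
  "history_energy p R \<phi> = p_energy p (lebesgue_on {-R..0}) \<phi> + norm (\<phi> 0) powr p"

lemma history_energy_cong:
  assumes "\<And>\<theta>. \<theta> \<in> {-R..0} \<Longrightarrow> \<phi> \<theta> = \<psi> \<theta>" "0 \<le> R"
  shows "history_energy p R \<phi> = history_energy p R \<psi>"
proof -
  have "p_energy p (lebesgue_on {-R..0}) \<phi> = p_energy p (lebesgue_on {-R..0}) \<psi>"
    unfolding p_energy_def using assms(1) by (intro Bochner_Integration.integral_cong) auto
  then show ?thesis using assms by (simp add: history_energy_def)
qed

lemma history_energy_triangle:
  assumes "0 \<le> p" "p_integrable p (lebesgue_on {-R..0}) x" "p_integrable p (lebesgue_on {-R..0}) y"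
    "p_integrable p (lebesgue_on {-R..0}) z"
  shows "history_energy p R (\<lambda>s. x s - z s)
    \<le> 2 powr p * (history_energy p R (\<lambda>s. x s - y s) + history_energy p R (\<lambda>s. y s - z s))"
  using p_energy_triangle[OF assms] norm_diff_powr_le[OF assms(1), of "x 0" "z 0" "y 0"]
  by (simp add: history_energy_def algebra_simps)

text \<open>
  All norms on \<open>\<real>\<^sup>N\<close> are equivalent, so the set of histories and its topology do not depend on the
  norm. Solutions can therefore be estimated in the Euclidean norm.
\<close>

lemma Lp_space_eq:
  fixes nrm :: "real ^ 'n \<Rightarrow> real"
  assumes "is_norm nrm" "0 < p"
  shows "Lp_space nrm p R = {\<phi> \<in> extensional {-R..0}. p_integrable p (lebesgue_on {-R..0}) \<phi>}"
proof -
  obtain c C where c: "0 < c" "0 < C" "\<And>x. c * norm x \<le> nrm x" "\<And>x. nrm x \<le> C * norm x"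
    and cont: "continuous_on UNIV nrm"
    using is_norm_equivalent[OF assms(1)] by metis
  have [measurable]: "nrm \<in> borel_measurable borel"
    using cont by (rule borel_measurable_continuous_onI)
  have "integrable (lebesgue_on {-R..0}) (\<lambda>\<theta>. nrm (\<phi> \<theta>) powr p)
      \<longleftrightarrow> integrable (lebesgue_on {-R..0}) (\<lambda>\<theta>. norm (\<phi> \<theta>) powr p)" (is "?l \<longleftrightarrow> ?r")
    if [measurable]: "\<phi> \<in> borel_measurable (lebesgue_on {-R..0})" for \<phi> :: "real \<Rightarrow> real ^ 'n"
  proof
    assume ?l
    show ?r
    proof (rule Bochner_Integration.integrable_bound)
      show "integrable (lebesgue_on {-R..0}) (\<lambda>\<theta>. (1 / c) powr p * nrm (\<phi> \<theta>) powr p)"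
        using \<open>?l\<close> by simp
      have "norm v powr p \<le> (1 / c) powr p * nrm v powr p" for v
      proof -
        have "norm v \<le> 1 / c * nrm v" using c(1) c(3)[of v] by (simp add: field_simps)
        then have "norm v powr p \<le> (1 / c * nrm v) powr p" using assms by (intro powr_mono2) auto
        also have "\<dots> = (1 / c) powr p * nrm v powr p"
          by (rule powr_mult)
        finally show ?thesis .
      qed
      then show "AE \<theta> in lebesgue_on {-R..0}. norm (norm (\<phi> \<theta>) powr p) \<le> norm ((1 / c) powr p * nrm (\<phi> \<theta>) powr p)"
        by simp
    qed measurable
  next
    assume ?r
    show ?l
    proof (rule Bochner_Integration.integrable_bound)
      show "integrable (lebesgue_on {-R..0}) (\<lambda>\<theta>. C powr p * norm (\<phi> \<theta>) powr p)"
        using \<open>?r\<close> by simp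
      have "nrm v powr p \<le> C powr p * norm v powr p" for v
      proof -
        have "nrm v powr p \<le> (C * norm v) powr p"
          using assms c(4) is_norm_nonneg[OF assms(1)] by (intro powr_mono2) auto
        also have "\<dots> = C powr p * norm v powr p" by (rule powr_mult)
        finally show ?thesis .
      qed
      then show "AE \<theta> in lebesgue_on {-R..0}. norm (nrm (\<phi> \<theta>) powr p) \<le> norm (C powr p * norm (\<phi> \<theta>) powr p)"
        by simp
    qed measurable
  qed
  then show ?thesis unfolding Lp_space_def p_integrable_def by blast
qed

lemma Lp_seminorm_equivalent:
  fixes nrm :: "real ^ 'n \<Rightarrow> real"
  assumes nrm: "is_norm nrm" and p: "0 < p"
  obtains c C where "0 < c" "0 < C"
    "\<And>\<phi>. p_integrable p (lebesgue_on {-R..0}) \<phi> \<Longrightarrow> c * history_energy p R \<phi> \<le> Lp_seminorm nrm p R \<phi> powr p"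
    "\<And>\<phi>. p_integrable p (lebesgue_on {-R..0}) \<phi> \<Longrightarrow> Lp_seminorm nrm p R \<phi> powr p \<le> C * history_energy p R \<phi>"
proof -
  obtain c C where c: "0 < c" "0 < C" "\<And>x. c * norm x \<le> nrm x" "\<And>x. nrm x \<le> C * norm x"
    and cont: "continuous_on UNIV nrm"
    using is_norm_equivalent[OF nrm] by metis
  have [measurable]: "nrm \<in> borel_measurable borel"
    using cont by (rule borel_measurable_continuous_onI)
  have lo: "c powr p * norm v powr p \<le> nrm v powr p" for v
    using powr_mono2[OF _ _ c(3)[of v], of p] p c(1) by (simp add: powr_mult)
  have up: "nrm v powr p \<le> C powr p * norm v powr p" for v
    using powr_mono2[OF _ _ c(4)[of v], of p] p c(2) is_norm_nonneg[OF nrm] by (simp add: powr_mult)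
  let ?M = "lebesgue_on {-R..0}"
  have *: "c powr p * history_energy p R \<phi> \<le> Lp_seminorm nrm p R \<phi> powr p \<and>
        Lp_seminorm nrm p R \<phi> powr p \<le> C powr p * history_energy p R \<phi>"
    if \<phi>: "p_integrable p ?M \<phi>" for \<phi>
  proof -
    have [measurable]: "\<phi> \<in> borel_measurable ?M" using \<phi> by (simp add: p_integrable_def)
    have i: "integrable ?M (\<lambda>\<theta>. norm (\<phi> \<theta>) powr p)" using \<phi> by (simp add: p_integrable_def)
    have j: "integrable ?M (\<lambda>\<theta>. nrm (\<phi> \<theta>) powr p)"
      by (rule Bochner_Integration.integrable_bound[of _ "\<lambda>\<theta>. C powr p * norm (\<phi> \<theta>) powr p"]) (use i up in auto)
    have s: "Lp_seminorm nrm p R \<phi> powr p = (\<integral>\<theta>. nrm (\<phi> \<theta>) powr p \<partial>?M) + nrm (\<phi> 0) powr p"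
      using p by (simp add: Lp_seminorm_def powr_powr integral_nonneg_AE)
    have "(\<integral>\<theta>. c powr p * norm (\<phi> \<theta>) powr p \<partial>?M) \<le> (\<integral>\<theta>. nrm (\<phi> \<theta>) powr p \<partial>?M)"
      "(\<integral>\<theta>. nrm (\<phi> \<theta>) powr p \<partial>?M) \<le> (\<integral>\<theta>. C powr p * norm (\<phi> \<theta>) powr p \<partial>?M)"
      by (intro integral_mono; use i j lo up in simp)+
    then show ?thesis
      using lo[of "\<phi> 0"] up[of "\<phi> 0"] unfolding s history_energy_def p_energy_def
      by (simp add: distrib_left)
  qed
  show ?thesis by (rule that[of "c powr p" "C powr p"]) (use c * in auto)
qed

lemma openin_Lp_topology_energy:
  fixes nrm :: "real ^ 'n \<Rightarrow> real"
  assumes nrm: "is_norm nrm" and p: "0 < p"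
  shows "openin (Lp_topology nrm p R) U \<longleftrightarrow> U \<subseteq> Lp_space nrm p R \<and>
    (\<forall>\<phi>\<in>U. \<exists>\<epsilon>>0. \<forall>\<psi>\<in>Lp_space nrm p R. history_energy p R (\<lambda>\<theta>. \<psi> \<theta> - \<phi> \<theta>) < \<epsilon> \<longrightarrow> \<psi> \<in> U)"
proof -
  obtain c C where c: "0 < c" "0 < C"
    and lo: "\<And>\<phi>. p_integrable p (lebesgue_on {-R..0}) \<phi> \<Longrightarrow> c * history_energy p R \<phi> \<le> Lp_seminorm nrm p R \<phi> powr p"
    and up: "\<And>\<phi>. p_integrable p (lebesgue_on {-R..0}) \<phi> \<Longrightarrow> Lp_seminorm nrm p R \<phi> powr p \<le> C * history_energy p R \<phi>"
    using Lp_seminorm_equivalent[OF assms] by metis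
  let ?L = "Lp_space nrm p R"
  have diff: "p_integrable p (lebesgue_on {-R..0}) (\<lambda>\<theta>. \<psi> \<theta> - \<phi> \<theta>)" if "\<phi> \<in> ?L" "\<psi> \<in> ?L" for \<phi> \<psi>
    using that p by (intro p_integrable_diff) (auto simp: Lp_space_eq[OF assms])
  have *: "(\<exists>\<epsilon>>0. \<forall>\<psi>\<in>?L. Lp_seminorm nrm p R (\<lambda>\<theta>. \<psi> \<theta> - \<phi> \<theta>) < \<epsilon> \<longrightarrow> \<psi> \<in> U)
     \<longleftrightarrow> (\<exists>\<epsilon>>0. \<forall>\<psi>\<in>?L. history_energy p R (\<lambda>\<theta>. \<psi> \<theta> - \<phi> \<theta>) < \<epsilon> \<longrightarrow> \<psi> \<in> U)" (is "?l \<longleftrightarrow> ?r")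
    if \<phi>: "\<phi> \<in> ?L" for \<phi>
  proof
    assume ?l
    then obtain \<epsilon> where \<epsilon>: "0 < \<epsilon>" "\<And>\<psi>. \<psi> \<in> ?L \<Longrightarrow> Lp_seminorm nrm p R (\<lambda>\<theta>. \<psi> \<theta> - \<phi> \<theta>) < \<epsilon> \<Longrightarrow> \<psi> \<in> U"
      by blast
    show ?r
    proof (intro exI[of _ "\<epsilon> powr p / C"] conjI ballI impI)
      fix \<psi> assume \<psi>: "\<psi> \<in> ?L" "history_energy p R (\<lambda>\<theta>. \<psi> \<theta> - \<phi> \<theta>) < \<epsilon> powr p / C"
      then have "C * history_energy p R (\<lambda>\<theta>. \<psi> \<theta> - \<phi> \<theta>) < \<epsilon> powr p"
        using c by (simp add: field_simps)
      then have "Lp_seminorm nrm p R (\<lambda>\<theta>. \<psi> \<theta> - \<phi> \<theta>) powr p < \<epsilon> powr p"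
        using up[OF diff[OF \<phi> \<psi>(1)]] by linarith
      then have "Lp_seminorm nrm p R (\<lambda>\<theta>. \<psi> \<theta> - \<phi> \<theta>) < \<epsilon>"
        using powr_mono2[of p \<epsilon> "Lp_seminorm nrm p R (\<lambda>\<theta>. \<psi> \<theta> - \<phi> \<theta>)"] p \<epsilon>(1) by (meson less_imp_le not_less)
      then show "\<psi> \<in> U" using \<epsilon>(2) \<psi>(1) by blast
    qed (use \<epsilon> c in simp)
  next
    assume ?r
    then obtain \<epsilon> where \<epsilon>: "0 < \<epsilon>" "\<And>\<psi>. \<psi> \<in> ?L \<Longrightarrow> history_energy p R (\<lambda>\<theta>. \<psi> \<theta> - \<phi> \<theta>) < \<epsilon> \<Longrightarrow> \<psi> \<in> U"
      by blast
    show ?l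
    proof (intro exI[of _ "(c * \<epsilon>) powr (1 / p)"] conjI ballI impI)
      fix \<psi> assume \<psi>: "\<psi> \<in> ?L" "Lp_seminorm nrm p R (\<lambda>\<theta>. \<psi> \<theta> - \<phi> \<theta>) < (c * \<epsilon>) powr (1 / p)"
      then have "Lp_seminorm nrm p R (\<lambda>\<theta>. \<psi> \<theta> - \<phi> \<theta>) powr p < ((c * \<epsilon>) powr (1 / p)) powr p"
        using p by (intro powr_less_mono2) (auto simp: Lp_seminorm_def)
      also have "\<dots> = c * \<epsilon>" using p c \<epsilon> by (simp add: powr_powr)
      finally have "history_energy p R (\<lambda>\<theta>. \<psi> \<theta> - \<phi> \<theta>) < \<epsilon>"
        using lo[OF diff[OF \<phi> \<psi>(1)]] c by (smt (verit) mult_less_cancel_left_pos)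
      then show "\<psi> \<in> U" using \<epsilon>(2) \<psi>(1) by blast
    qed (use \<epsilon> c in simp)
  qed
  have "(\<forall>\<phi>\<in>U. \<exists>\<epsilon>>0. \<forall>\<psi>\<in>?L. Lp_seminorm nrm p R (\<lambda>\<theta>. \<psi> \<theta> - \<phi> \<theta>) < \<epsilon> \<longrightarrow> \<psi> \<in> U)
     \<longleftrightarrow> (\<forall>\<phi>\<in>U. \<exists>\<epsilon>>0. \<forall>\<psi>\<in>?L. history_energy p R (\<lambda>\<theta>. \<psi> \<theta> - \<phi> \<theta>) < \<epsilon> \<longrightarrow> \<psi> \<in> U)"
    if "U \<subseteq> ?L"
    using that by (intro ball_cong[OF refl] *) blast
  then show ?thesis unfolding openin_Lp_topology by (rule conj_cong[OF refl])
qed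

text \<open>
  A ball for the energy need not be open, because the triangle inequality carries the factor \<open>2\<^sup>p\<close>. The points
  around which some ball still fits into the given one form an open set, as in any uniform space.
\<close>

lemma Lp_neighbourhood:
  fixes nrm :: "real ^ 'n \<Rightarrow> real"
  assumes nrm: "is_norm nrm" and p: "0 < p" and d: "0 < d" and \<phi>: "\<phi> \<in> Lp_space nrm p R"
  obtains W where "openin (Lp_topology nrm p R) W" "\<phi> \<in> W"
    "\<And>\<psi>. \<psi> \<in> W \<Longrightarrow> history_energy p R (\<lambda>\<theta>. \<psi> \<theta> - \<phi> \<theta>) < d"
proof -
  let ?L = "Lp_space nrm p R"
  let ?E = "\<lambda>\<psi> \<phi>. history_energy p R (\<lambda>\<theta>. \<psi> \<theta> - \<phi> \<theta>)"
  define W where "W = {\<psi>\<in>?L. \<exists>\<epsilon>>0. \<forall>\<xi>\<in>?L. ?E \<xi> \<psi> < \<epsilon> \<longrightarrow> ?E \<xi> \<phi> < d}"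
  have self: "?E \<psi> \<psi> = 0" for \<psi> using p by (simp add: history_energy_def p_energy_def)
  have "openin (Lp_topology nrm p R) W"
    unfolding openin_Lp_topology_energy[OF nrm p]
  proof (intro conjI ballI)
    show "W \<subseteq> ?L" by (auto simp: W_def)
    fix \<psi> assume "\<psi> \<in> W"
    then obtain \<epsilon> where \<psi>: "\<psi> \<in> ?L" and \<epsilon>: "0 < \<epsilon>" "\<And>\<xi>. \<xi> \<in> ?L \<Longrightarrow> ?E \<xi> \<psi> < \<epsilon> \<Longrightarrow> ?E \<xi> \<phi> < d"
      by (auto simp: W_def)
    \<comment> \<open>halved for the two summands and divided by the factor of the triangle inequality\<close>
    define \<epsilon>' where "\<epsilon>' = \<epsilon> / (2 * 2 powr p)"
    have \<epsilon>': "0 < \<epsilon>'" using \<epsilon>(1) by (simp add: \<epsilon>'_def)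
    have "\<xi> \<in> W" if \<xi>: "\<xi> \<in> ?L" "?E \<xi> \<psi> < \<epsilon>'" for \<xi>
    proof -
      have "?E \<omega> \<phi> < d" if \<omega>: "\<omega> \<in> ?L" "?E \<omega> \<xi> < \<epsilon>'" for \<omega>
      proof (rule \<epsilon>(2)[OF \<omega>(1)])
        have "?E \<omega> \<psi> \<le> 2 powr p * (?E \<omega> \<xi> + ?E \<xi> \<psi>)"
          using p \<omega> \<xi> \<psi> by (intro history_energy_triangle) (auto simp: Lp_space_eq[OF nrm p])
        also have "\<dots> < 2 powr p * (\<epsilon>' + \<epsilon>')"
          using \<omega> \<xi> by (intro mult_strict_left_mono) auto
        also have "\<dots> = \<epsilon>" by (simp add: \<epsilon>'_def)
        finally show "?E \<omega> \<psi> < \<epsilon>" .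
      qed
      then show ?thesis using \<xi>(1) \<epsilon>' by (auto simp: W_def)
    qed
    then show "\<exists>\<epsilon>>0. \<forall>\<xi>\<in>?L. ?E \<xi> \<psi> < \<epsilon> \<longrightarrow> \<xi> \<in> W" using \<epsilon>' by blast
  qed
  moreover have "\<phi> \<in> W" using \<phi> d by (auto simp: W_def)
  moreover have "?E \<psi> \<phi> < d" if W: "\<psi> \<in> W" for \<psi>
  proof -
    obtain \<epsilon> where "\<psi> \<in> ?L" "0 < \<epsilon>" "\<forall>\<xi>\<in>?L. ?E \<xi> \<psi> < \<epsilon> \<longrightarrow> ?E \<xi> \<phi> < d"
      using W unfolding W_def by blast
    then show ?thesis using self[of \<psi>] by auto
  qed
  ultimately show ?thesis by (rule that)
qed

lemma continuous_map_Lp_topologyI: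
  fixes nrm :: "real ^ 'n \<Rightarrow> real"
  assumes nrm: "is_norm nrm" and p: "0 < p"
    and maps: "\<Phi> \<in> {0..} \<times> Lp_space nrm p R \<rightarrow> Lp_space nrm p R"
    and cont: "\<And>t \<phi> e. \<lbrakk>0 \<le> t; \<phi> \<in> Lp_space nrm p R; 0 < e\<rbrakk> \<Longrightarrow>
      \<exists>d>0. \<forall>s\<ge>0. \<forall>\<psi>\<in>Lp_space nrm p R. \<bar>s - t\<bar> < d \<longrightarrow>
        history_energy p R (\<lambda>\<theta>. \<psi> \<theta> - \<phi> \<theta>) < d \<longrightarrow>
        history_energy p R (\<lambda>\<theta>. \<Phi> (s, \<psi>) \<theta> - \<Phi> (t, \<phi>) \<theta>) < e"
  shows "continuous_map (prod_topology (top_of_set {0..}) (Lp_topology nrm p R)) (Lp_topology nrm p R) \<Phi>"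
  unfolding continuous_map_def
proof (intro conjI allI impI)
  let ?L = "Lp_space nrm p R" and ?T = "Lp_topology nrm p R"
  show "\<Phi> \<in> topspace (prod_topology (top_of_set {0..}) ?T) \<rightarrow> topspace ?T"
    using maps by (simp add: topspace_Lp_topology)
  fix U assume U: "openin ?T U"
  show "openin (prod_topology (top_of_set {0..}) ?T)
      {z \<in> topspace (prod_topology (top_of_set {0..}) ?T). \<Phi> z \<in> U}"
    unfolding openin_prod_topology_alt
  proof (intro allI impI)
    fix t :: real and \<phi>
    assume "(t, \<phi>) \<in> {z \<in> topspace (prod_topology (top_of_set {0..}) ?T). \<Phi> z \<in> U}"
    then have t: "0 \<le> t" and \<phi>: "\<phi> \<in> ?L" and "\<Phi> (t, \<phi>) \<in> U"
      by (auto simp: topspace_Lp_topology)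
    then obtain e where e: "0 < e"
      "\<And>\<psi>. \<psi> \<in> ?L \<Longrightarrow> history_energy p R (\<lambda>\<theta>. \<psi> \<theta> - \<Phi> (t, \<phi>) \<theta>) < e \<Longrightarrow> \<psi> \<in> U"
      using iffD1[OF openin_Lp_topology_energy[OF nrm p] U] by blast
    obtain d where d: "0 < d"
      "\<And>s \<psi>. \<lbrakk>0 \<le> s; \<psi> \<in> ?L; \<bar>s - t\<bar> < d; history_energy p R (\<lambda>\<theta>. \<psi> \<theta> - \<phi> \<theta>) < d\<rbrakk> \<Longrightarrow>
        history_energy p R (\<lambda>\<theta>. \<Phi> (s, \<psi>) \<theta> - \<Phi> (t, \<phi>) \<theta>) < e"
      using cont[OF t \<phi> e(1)] by blast
    obtain W where W: "openin ?T W" "\<phi> \<in> W" "\<And>\<psi>. \<psi> \<in> W \<Longrightarrow> history_energy p R (\<lambda>\<theta>. \<psi> \<theta> - \<phi> \<theta>) < d"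
      using Lp_neighbourhood[OF nrm p d(1) \<phi>] by metis
    have WL: "W \<subseteq> ?L" using W(1) openin_subset by (fastforce simp: topspace_Lp_topology)
    let ?V = "{0..} \<inter> ball t d"
    have "openin (top_of_set {0..}) ?V" by (auto simp: openin_open)
    moreover have "?V \<times> W \<subseteq> {z \<in> topspace (prod_topology (top_of_set {0..}) ?T). \<Phi> z \<in> U}"
    proof
      fix z assume "z \<in> ?V \<times> W"
      then obtain s \<psi> where z: "z = (s, \<psi>)" and s: "s \<in> {0..}" "s \<in> ball t d" and \<psi>: "\<psi> \<in> W"
        by blast
      have "\<Phi> (s, \<psi>) \<in> U"
        using s \<psi> W(3) WL maps by (intro e(2) d(2)) (auto simp: dist_real_def)
      then show "z \<in> {z \<in> topspace (prod_topology (top_of_set {0..}) ?T). \<Phi> z \<in> U}"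
        using z s \<psi> WL by (auto simp: topspace_Lp_topology)
    qed
    ultimately show "\<exists>V W. openin (top_of_set {0..}) V \<and> openin ?T W \<and> t \<in> V \<and> \<phi> \<in> W \<and>
        V \<times> W \<subseteq> {z \<in> topspace (prod_topology (top_of_set {0..}) ?T). \<Phi> z \<in> U}"
      using t d(1) W by (intro exI[of _ ?V] exI[of _ W]) auto
  qed
qed

section \<open>Solutions of the delay equation\<close>

text \<open>
  The method of steps as a recursion: the value at \<open>t > 0\<close> depends on values at times at most
  \<open>t - r\<close>, so the number of delay steps needed to get from \<open>t\<close> back to the history decreases. The
  congruence rule is what lets the recursive calls be restricted to \<open>s \<in> [0,t]\<close>; the case
  \<open>r \<le> 0\<close> is cut off to keep the recursion well founded for every \<open>r\<close>.
\<close>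

context
  notes Bochner_Integration.integral_cong [fundef_cong]
begin

function delay_flow ::
  "(real ^ 'n \<Rightarrow> real ^ 'n) \<Rightarrow> real \<Rightarrow> (real \<Rightarrow> real ^ 'n) \<Rightarrow> real \<Rightarrow> real ^ 'n" where
  "delay_flow f r \<phi> t = (if t \<le> 0 \<or> r \<le> 0 then \<phi> t
     else \<phi> 0 + (\<integral>s. f (delay_flow f r \<phi> (s - r)) \<partial>lebesgue_on {0..t}))"
  by pat_completeness auto
termination
proof (relation "Wellfounded.measure (\<lambda>(f, r, \<phi>, t). nat \<lceil>t / r\<rceil>)", goal_cases)
  case (2 f r \<phi> t s)
  then have s: "0 \<le> s" "s \<le> t" "0 < t" "0 < r" by auto
  then have "(s - r) / r \<le> t / r - 1" by (simp add: field_simps)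
  then have "\<lceil>(s - r) / r\<rceil> \<le> \<lceil>t / r\<rceil> - 1" using ceiling_mono by fastforce
  moreover have "0 < \<lceil>t / r\<rceil>" using s by simp
  ultimately show ?case by simp
qed simp

end

declare delay_flow.simps [simp del]

locale delay_equation =
  fixes f :: "real ^ 'n \<Rightarrow> real ^ 'n" and R r p A :: real
  assumes r_pos: "0 < r" and r_le: "r \<le> R" and p_pos: "0 < p"
    and cont_f: "continuous_on UNIV f"
    and growth: "\<And>u. norm (f u) \<le> A * (1 + norm u powr p)"
begin

definition histories :: "(real \<Rightarrow> real ^ 'n) set" where
  "histories = {\<phi> \<in> extensional {-R..0}. p_integrable p (lebesgue_on {-R..0}) \<phi>}"

text \<open>
  The equation of a solution without its regularity clauses: for a history with integrable
  \<open>p\<close>-th power, continuity and integrability follow from the equation.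
\<close>

definition mild_solution :: "(real \<Rightarrow> real ^ 'n) \<Rightarrow> (real \<Rightarrow> real ^ 'n) \<Rightarrow> bool" where
  "mild_solution \<phi> x \<longleftrightarrow> (\<forall>\<theta>\<in>{-R..0}. x \<theta> = \<phi> \<theta>) \<and>
     (\<forall>t\<ge>0. x t = \<phi> 0 + (\<integral>s. f (x (s - r)) \<partial>lebesgue_on {0..t}))"

text \<open>
  On \<open>[0, T + r]\<close> the right-hand side evaluates \<open>x\<close> on \<open>[-r, T]\<close> only, which gains one delay per step.
\<close>

lemma integrable_delayed:
  assumes x: "p_integrable p (lebesgue_on {-R..T}) x"
  shows "integrable (lebesgue_on {0..T + r}) (\<lambda>s. f (x (s - r)))"
proof -
  have "p_integrable p (lebesgue_on {-r..T}) x"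
    using x r_le by (intro p_integrable_subinterval[OF x]) auto
  then have "integrable (lebesgue_on {-r..T}) (\<lambda>s. f (x s))"
    by (rule integrable_compose_growth[OF finite_measure_lebesgue_on cont_f growth, rotated]) auto
  then show ?thesis
    using integrable_shift_Icc[of 0 "T + r" "\<lambda>s. f (x s)" "-r"] by simp
qed

lemma mild_solution_step:
  assumes sol: "mild_solution \<phi> x" and T: "0 \<le> T" and x: "p_integrable p (lebesgue_on {-R..T}) x"
  shows "continuous_on {0..T + r} x" "p_integrable p (lebesgue_on {-R..T + r}) x"
proof -
  have "continuous_on {0..T + r} (\<lambda>t. \<phi> 0 + (\<integral>s. f (x (s - r)) \<partial>lebesgue_on {0..t}))"
    by (intro continuous_intros indefinite_integral_continuous_real integrable_delayed[OF x])
  then show c: "continuous_on {0..T + r} x"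
    by (rule continuous_on_eq) (use sol in \<open>auto simp: mild_solution_def\<close>)
  have "p_integrable p (lebesgue_on {T..T + r}) x"
    using T p_pos by (intro p_integrable_continuous continuous_on_subset[OF c]) auto
  then show "p_integrable p (lebesgue_on {-R..T + r}) x"
    by (rule p_integrable_combine[OF x]) (use T r_pos r_le in auto)
qed

text \<open>
  Regularity propagates: a \<open>p\<close>-integrable \<open>x\<close> up to time \<open>T\<close> makes \<open>x\<close> an indefinite integral, hence
  continuous, up to time \<open>T + r\<close>. Every time is reached after finitely many steps.
\<close>

lemma mild_solution_p_integrable:
  assumes \<phi>: "\<phi> \<in> histories" and sol: "mild_solution \<phi> x"
  shows "p_integrable p (lebesgue_on {-R..T}) x"
proof -
  have steps: "p_integrable p (lebesgue_on {-R..real n * r}) x" for n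
  proof (induction n)
    case 0
    have "p_integrable p (lebesgue_on {-R..0}) x \<longleftrightarrow> p_integrable p (lebesgue_on {-R..0}) \<phi>"
      using sol unfolding p_integrable_def mild_solution_def
      by (intro conj_cong measurable_lebesgue_cong Bochner_Integration.integrable_cong) auto
    then show ?case using \<phi> by (simp add: histories_def)
  next
    case (Suc n)
    then show ?case using mild_solution_step(2)[OF sol, of "real n * r"] r_pos
      by (simp add: algebra_simps)
  qed
  obtain n :: nat where "T / r \<le> real n" using real_arch_simple by blast
  then show ?thesis
    using r_pos by (intro p_integrable_subinterval[OF steps[of n]]) (auto simp: field_simps)
qed

lemma mild_solution_continuous:
  assumes "\<phi> \<in> histories" "mild_solution \<phi> x"
  shows "continuous_on {0..} x"
  unfolding continuous_on_eq_continuous_within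
proof
  fix t :: real assume t: "t \<in> {0..}"
  have "continuous_on {0..t + r} x"
    using mild_solution_step(1)[OF assms(2) _ mild_solution_p_integrable[OF assms, of t]] t by simp
  then have "continuous (at t within {0..t + r}) x"
    using t r_pos by (simp add: continuous_on_eq_continuous_within)
  moreover have "at t within {0..t + r} = at t within {0..}"
    by (rule at_within_nhd[where S="{..<t + r}"]) (use r_pos in auto)
  ultimately show "continuous (at t within {0..}) x" by simp
qed

lemma mild_solution_unique:
  assumes "mild_solution \<phi> x" "mild_solution \<phi> y" "-R \<le> t"
  shows "x t = y t"
proof -
  have "\<forall>t\<in>{-R..real n * r}. x t = y t" for n
  proof (induction n)
    case 0
    then show ?case using assms by (simp add: mild_solution_def)
  next
    case (Suc n)
    show ?case
    proof
      fix t assume t: "t \<in> {-R..real (Suc n) * r}"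
      show "x t = y t"
      proof (cases "t \<le> 0")
        case True
        then show ?thesis using t assms by (simp add: mild_solution_def)
      next
        case False
        have "(\<integral>s. f (x (s - r)) \<partial>lebesgue_on {0..t}) = (\<integral>s. f (y (s - r)) \<partial>lebesgue_on {0..t})"
        proof (intro Bochner_Integration.integral_cong refl)
          fix s assume "s \<in> space (lebesgue_on {0..t})"
          then have "s - r \<in> {-R..real n * r}" using t r_le by (auto simp: algebra_simps)
          then show "f (x (s - r)) = f (y (s - r))" using Suc by simp
        qed
        then show ?thesis using False assms by (simp add: mild_solution_def)
      qed
    qed
  qed
  moreover obtain n :: nat where "t / r \<le> real n" using real_arch_simple by blast
  then have "t \<in> {-R..real n * r}" using assms(3) r_pos by (simp add: field_simps)
  ultimately show ?thesis by blast
qed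

text \<open>
  Existence and uniqueness can be settled for the bare integral equation, where \<open>delay_flow\<close> provides a
  solution and uniqueness is an induction over the steps.
\<close>

lemma is_solution_iff:
  assumes "\<phi> \<in> histories"
  shows "is_solution f R r \<phi> x \<longleftrightarrow> x \<in> extensional {-R..} \<and> mild_solution \<phi> x"
proof
  show "is_solution f R r \<phi> x \<Longrightarrow> x \<in> extensional {-R..} \<and> mild_solution \<phi> x"
    by (simp add: is_solution_def mild_solution_def)
  assume x: "x \<in> extensional {-R..} \<and> mild_solution \<phi> x"
  have "integrable (lebesgue_on {0..t}) (\<lambda>s. f (x (s - r)))" for t
    using integrable_delayed[OF mild_solution_p_integrable[OF assms], of x "t - r"] x by simp
  then show "is_solution f R r \<phi> x"
    using x mild_solution_continuous[OF assms] by (simp add: is_solution_def mild_solution_def)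
qed

lemma mild_solution_restrict:
  assumes "mild_solution \<phi> x"
  shows "mild_solution \<phi> (restrict x {-R..})"
proof -
  have "(\<integral>s. f (restrict x {-R..} (s - r)) \<partial>lebesgue_on {0..t}) = (\<integral>s. f (x (s - r)) \<partial>lebesgue_on {0..t})" for t
    using r_le by (intro Bochner_Integration.integral_cong) auto
  then show ?thesis using assms r_pos r_le by (simp add: mild_solution_def)
qed

lemma mild_solution_delay_flow: "mild_solution \<phi> (delay_flow f r \<phi>)"
proof -
  have "delay_flow f r \<phi> t = \<phi> 0 + (\<integral>s. f (delay_flow f r \<phi> (s - r)) \<partial>lebesgue_on {0..t})"
    if "0 \<le> t" for t
  proof (cases "t = 0")
    case True
    have "{0::real} \<in> null_sets lebesgue" by (simp add: negligible_iff_null_sets[symmetric])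
    then show ?thesis using True
      by (simp add: delay_flow.simps[of f r \<phi> 0] integral_eq_zero_null_sets)
  qed (use that r_pos in \<open>simp add: delay_flow.simps[of f r \<phi> t]\<close>)
  moreover have "delay_flow f r \<phi> \<theta> = \<phi> \<theta>" if "\<theta> \<in> {-R..0}" for \<theta>
    using that by (simp add: delay_flow.simps[of f r \<phi> \<theta>])
  ultimately show ?thesis unfolding mild_solution_def by blast
qed

lemma solution_eqI:
  assumes "\<phi> \<in> histories" "mild_solution \<phi> x" "x \<in> extensional {-R..}"
  shows "solution f R r \<phi> = x"
  unfolding solution_def
proof (rule the_equality)
  show "is_solution f R r \<phi> x" using assms by (simp add: is_solution_iff)
  fix y assume "is_solution f R r \<phi> y"
  then have "y \<in> extensional {-R..}" "mild_solution \<phi> y" using assms by (simp_all add: is_solution_iff)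
  then show "y = x"
    using assms mild_solution_unique by (intro extensionalityI) auto
qed

lemma mild_solution_solution:
  assumes "\<phi> \<in> histories"
  shows "mild_solution \<phi> (solution f R r \<phi>)"
  using solution_eqI[OF assms mild_solution_restrict[OF mild_solution_delay_flow]]
    mild_solution_restrict[OF mild_solution_delay_flow[of \<phi>]] by simp

abbreviation "sol \<equiv> solution f R r"

lemma sol_p_integrable: "\<phi> \<in> histories \<Longrightarrow> p_integrable p (lebesgue_on {-R..T}) (sol \<phi>)"
  by (rule mild_solution_p_integrable[OF _ mild_solution_solution])

lemma sol_continuous: "\<phi> \<in> histories \<Longrightarrow> continuous_on {0..} (sol \<phi>)"
  by (rule mild_solution_continuous[OF _ mild_solution_solution])

lemma sol_history: "\<phi> \<in> histories \<Longrightarrow> \<theta> \<in> {-R..0} \<Longrightarrow> sol \<phi> \<theta> = \<phi> \<theta>"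
  using mild_solution_solution by (auto simp: mild_solution_def)

lemma sol_integral:
  "\<phi> \<in> histories \<Longrightarrow> 0 \<le> t \<Longrightarrow> sol \<phi> t = \<phi> 0 + (\<integral>s. f (sol \<phi> (s - r)) \<partial>lebesgue_on {0..t})"
  using mild_solution_solution by (auto simp: mild_solution_def)

lemma integrable_sol:
  "\<phi> \<in> histories \<Longrightarrow> integrable (lebesgue_on {0..t}) (\<lambda>s. f (sol \<phi> (s - r)))"
  using integrable_delayed[of "t - r"] sol_p_integrable by simp

lemma p_integrable_sol_segment:
  assumes "\<phi> \<in> histories" "0 \<le> t"
  shows "p_integrable p (lebesgue_on {-R..0}) (\<lambda>\<theta>. sol \<phi> (t + \<theta>))"
  using assms p_integrable_shift[of p "-R" t 0 "sol \<phi>"]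
    p_integrable_subinterval[OF sol_p_integrable[of \<phi> t], of "-R + t" t]
  by (simp add: add.commute)

lemma history_in_histories:
  assumes "\<phi> \<in> histories" "0 \<le> t"
  shows "history R t (sol \<phi>) \<in> histories"
proof -
  have "p_integrable p (lebesgue_on {-R..0}) (history R t (sol \<phi>))
      \<longleftrightarrow> p_integrable p (lebesgue_on {-R..0}) (\<lambda>\<theta>. sol \<phi> (t + \<theta>))"
    unfolding p_integrable_def
    by (intro conj_cong measurable_lebesgue_cong Bochner_Integration.integrable_cong)
      (auto simp: history_def)
  then show ?thesis
    using p_integrable_sol_segment[OF assms] by (simp add: histories_def history_def)
qed

text \<open>
  The equation is autonomous: splitting the integral at \<open>t\<close> shows that the translate of a solution
  solves the equation for its own history at \<open>t\<close>. Uniqueness turns this into the semigroup law.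
\<close>

lemma solution_of_history:
  assumes \<phi>: "\<phi> \<in> histories" and t: "0 \<le> t"
  shows "sol (history R t (sol \<phi>)) = restrict (\<lambda>s. sol \<phi> (t + s)) {-R..}"
proof (rule solution_eqI[OF history_in_histories[OF assms] mild_solution_restrict])
  show "mild_solution (history R t (sol \<phi>)) (\<lambda>s. sol \<phi> (t + s))"
    unfolding mild_solution_def
  proof (intro conjI ballI allI impI)
    fix s :: real assume s: "0 \<le> s"
    let ?g = "\<lambda>s. f (sol \<phi> (s - r))"
    have "(\<integral>u. f (sol \<phi> (t + (u - r))) \<partial>lebesgue_on {0..s}) = (\<integral>u. ?g u \<partial>lebesgue_on {t..t + s})"
      using integral_shift_Icc[of 0 s ?g t] by (simp add: algebra_simps)
    moreover have "(\<integral>u. ?g u \<partial>lebesgue_on {0..t + s})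
        = (\<integral>u. ?g u \<partial>lebesgue_on {0..t}) + (\<integral>u. ?g u \<partial>lebesgue_on {t..t + s})"
      using s t by (intro integral_combine integrable_sol \<phi>) auto
    moreover have "history R t (sol \<phi>) 0 = sol \<phi> t"
      using r_pos r_le by (simp add: history_def)
    ultimately show "sol \<phi> (t + s) = history R t (sol \<phi>) 0
        + (\<integral>u. f (sol \<phi> (t + (u - r))) \<partial>lebesgue_on {0..s})"
      using s t sol_integral[OF \<phi>, of t] sol_integral[OF \<phi>, of "t + s"] by simp
  qed (simp add: history_def)
qed simp

lemma semiflow_histories: "semiflow histories (solution_semiflow f R r)"
  unfolding semiflow_def
proof (intro conjI ballI allI impI)
  show "solution_semiflow f R r \<in> {0..} \<times> histories \<rightarrow> histories"
    using history_in_histories by (auto simp: solution_semiflow_def)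
  fix \<phi> assume \<phi>: "\<phi> \<in> histories"
  show "solution_semiflow f R r (0, \<phi>) = \<phi>"
    using \<phi> sol_history[OF \<phi>]
    by (intro extensionalityI[of _ "{-R..0}"]) (auto simp: solution_semiflow_def history_def histories_def)
  fix t s :: real assume ts: "0 \<le> t" "0 \<le> s"
  have "solution_semiflow f R r (s, solution_semiflow f R r (t, \<phi>))
      = history R s (restrict (\<lambda>u. sol \<phi> (t + u)) {-R..})"
    using ts by (simp add: solution_semiflow_def solution_of_history[OF \<phi>])
  also have "\<dots> = history R (t + s) (sol \<phi>)"
    using ts by (auto simp: history_def add.assoc intro!: restrict_ext)
  finally show "solution_semiflow f R r (t + s, \<phi>)
      = solution_semiflow f R r (s, solution_semiflow f R r (t, \<phi>))"
    by (simp add: solution_semiflow_def)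
qed

section \<open>Joint continuity of the semiflow\<close>

text \<open>
  Closeness of the energies up to time \<open>T\<close> becomes uniform closeness up to time \<open>T + r\<close>, because the
  difference of the solutions on \<open>[0, T + r]\<close> is bounded by the difference at \<open>0\<close> plus the integral over \<open>[-r, T]\<close> of
  the difference of the values of \<open>f\<close>, and the superposition operator is continuous. The weight of the point \<open>0\<close> in
  the seminorm controls the first of these terms.
\<close>

lemma dependence_step:
  assumes \<phi>: "\<phi> \<in> histories" and T: "0 \<le> T" and e: "0 < e"
  obtains d where "0 < d"
    "\<And>\<psi> t. \<lbrakk>\<psi> \<in> histories; p_energy p (lebesgue_on {-R..T}) (\<lambda>s. sol \<psi> s - sol \<phi> s) < d;
        norm (\<psi> 0 - \<phi> 0) < d; t \<in> {0..T + r}\<rbrakk> \<Longrightarrow> norm (sol \<psi> t - sol \<phi> t) < e"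
proof -
  let ?M = "lebesgue_on {-r..T}"
  have sub: "{-r..T} \<subseteq> {-R..T}" using r_le by auto
  have fin: "finite_measure ?M" by (rule finite_measure_lebesgue_on) simp
  have M: "p_integrable p ?M (sol \<psi>)" if "\<psi> \<in> histories" for \<psi>
    using sol_p_integrable[OF that] sub by (rule p_integrable_subinterval)
  obtain d where d: "0 < d" "\<And>y. p_integrable p ?M y \<Longrightarrow> p_energy p ?M (\<lambda>s. y s - sol \<phi> s) < d \<Longrightarrow>
       (\<integral>s. norm (f (y s) - f (sol \<phi> s)) \<partial>?M) < e / 2"
    using nemytskii_continuous[OF fin p_pos cont_f growth M[OF \<phi>] half_gt_zero[OF e]] by blast
  show ?thesis
  proof (rule that[of "min d (e / 2)"])
    show "0 < min d (e / 2)" using d e by simp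
    fix \<psi> t assume \<psi>: "\<psi> \<in> histories" and t: "t \<in> {0..T + r}"
      and E: "p_energy p (lebesgue_on {-R..T}) (\<lambda>s. sol \<psi> s - sol \<phi> s) < min d (e / 2)"
      and zero: "norm (\<psi> 0 - \<phi> 0) < min d (e / 2)"
    have "p_energy p ?M (\<lambda>s. sol \<psi> s - sol \<phi> s) \<le> p_energy p (lebesgue_on {-R..T}) (\<lambda>s. sol \<psi> s - sol \<phi> s)"
      using p_pos \<phi> \<psi> by (intro p_energy_mono_interval[OF _ sub] p_integrable_diff sol_p_integrable) auto
    then have small: "(\<integral>s. norm (f (sol \<psi> s) - f (sol \<phi> s)) \<partial>?M) < e / 2"
      using E by (intro d(2) M \<psi>) linarith
    let ?h = "\<lambda>s. f (sol \<psi> (s - r)) - f (sol \<phi> (s - r))"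
    have h: "integrable (lebesgue_on {0..u}) ?h" for u
      using \<phi> \<psi> integrable_sol by simp
    have "norm (\<integral>s. ?h s \<partial>lebesgue_on {0..t}) \<le> (\<integral>s. norm (?h s) \<partial>lebesgue_on {0..t})"
      by (rule integral_norm_bound)
    also have "\<dots> \<le> (\<integral>s. norm (?h s) \<partial>lebesgue_on {0..T + r})"
      using t h by (intro integral_mono_lebesgue_on_AE) auto
    also have "\<dots> = (\<integral>s. norm (f (sol \<psi> s) - f (sol \<phi> s)) \<partial>?M)"
      using integral_shift_Icc[of 0 "T + r" "\<lambda>s. norm (f (sol \<psi> s) - f (sol \<phi> s))" "-r"] by simp
    finally have "norm (\<integral>s. ?h s \<partial>lebesgue_on {0..t}) < e / 2" using small by linarith
    moreover have "sol \<psi> t - sol \<phi> t = (\<psi> 0 - \<phi> 0) + (\<integral>s. ?h s \<partial>lebesgue_on {0..t})"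
      using t \<phi> \<psi> integrable_sol by (simp add: sol_integral)
    ultimately show "norm (sol \<psi> t - sol \<phi> t) < e"
      using zero norm_triangle_ineq[of "\<psi> 0 - \<phi> 0" "\<integral>s. ?h s \<partial>lebesgue_on {0..t}"] by simp
  qed
qed

lemma norm_at_0_less:
  assumes "history_energy p R \<phi> < d powr p" "0 < d"
  shows "norm (\<phi> 0) < d"
proof -
  have "norm (\<phi> 0) powr p < d powr p"
    using assms p_energy_nonneg[of p "lebesgue_on {-R..0}" \<phi>] by (simp add: history_energy_def)
  then show ?thesis using powr_mono2[of p d "norm (\<phi> 0)"] assms p_pos by (meson less_imp_le not_less)
qed

text \<open>
  Induction over the delay steps: on the new interval of length \<open>r\<close> the uniform bound from the previous
  lemma is integrated, so that the energy is again small.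
\<close>

lemma dependence_steps:
  assumes \<phi>: "\<phi> \<in> histories"
  shows "0 < e \<Longrightarrow> \<exists>d>0. \<forall>\<psi>\<in>histories. history_energy p R (\<lambda>\<theta>. \<psi> \<theta> - \<phi> \<theta>) < d \<longrightarrow>
      p_energy p (lebesgue_on {-R..real n * r}) (\<lambda>s. sol \<psi> s - sol \<phi> s) < e"
proof (induction n arbitrary: e)
  case 0
  have "p_energy p (lebesgue_on {-R..0}) (\<lambda>s. sol \<psi> s - sol \<phi> s) \<le> history_energy p R (\<lambda>\<theta>. \<psi> \<theta> - \<phi> \<theta>)"
    if \<psi>: "\<psi> \<in> histories" for \<psi>
  proof -
    have "history_energy p R (\<lambda>s. sol \<psi> s - sol \<phi> s) = history_energy p R (\<lambda>\<theta>. \<psi> \<theta> - \<phi> \<theta>)"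
      using \<phi> \<psi> r_pos r_le by (intro history_energy_cong) (auto simp: sol_history)
    moreover have "0 \<le> norm (sol \<psi> 0 - sol \<phi> 0) powr p" by simp
    ultimately show ?thesis unfolding history_energy_def[of p R "\<lambda>s. sol \<psi> s - sol \<phi> s"] by linarith
  qed
  then show ?case using 0 by (intro exI[of _ e]) fastforce
next
  case (Suc n)
  let ?T = "real n * r"
  let ?E = "\<lambda>\<psi> a b. p_energy p (lebesgue_on {a..b}) (\<lambda>s. sol \<psi> s - sol \<phi> s)"
  have T: "0 \<le> ?T" "real (Suc n) * r = ?T + r" using r_pos by (auto simp: algebra_simps)
  \<comment> \<open>an error of at most \<open>\<omega>\<close> throughout a step has energy at most \<open>e/2\<close>\<close>
  define \<omega> where "\<omega> = (e / (2 * r)) powr (1 / p)"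
  have \<omega>: "0 < \<omega>" "r * \<omega> powr p = e / 2"
    using r_pos p_pos Suc.prems by (auto simp: \<omega>_def powr_powr)
  obtain d where d: "0 < d" "\<And>\<psi> t. \<lbrakk>\<psi> \<in> histories; ?E \<psi> (-R) ?T < d;
        norm (\<psi> 0 - \<phi> 0) < d; t \<in> {0..?T + r}\<rbrakk> \<Longrightarrow> norm (sol \<psi> t - sol \<phi> t) < \<omega>"
    using dependence_step[OF \<phi> T(1) \<omega>(1)] by blast
  obtain d' where d': "0 < d'" "\<And>\<psi>. \<psi> \<in> histories \<Longrightarrow> history_energy p R (\<lambda>\<theta>. \<psi> \<theta> - \<phi> \<theta>) < d' \<Longrightarrow>
      ?E \<psi> (-R) ?T < min d (e / 2)"
    using Suc.IH[of "min d (e / 2)"] d(1) Suc.prems by auto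
  show ?case
  proof (intro exI[of _ "min d' (d powr p)"] conjI ballI impI)
    show "0 < min d' (d powr p)" using d d' by simp
    fix \<psi> assume \<psi>: "\<psi> \<in> histories" and small: "history_energy p R (\<lambda>\<theta>. \<psi> \<theta> - \<phi> \<theta>) < min d' (d powr p)"
    have RT: "-R \<le> ?T" using T(1) r_pos r_le by linarith
    have near: "?E \<psi> (-R) ?T < min d (e / 2)" using small by (intro d'(2) \<psi>) simp
    have zero: "norm (\<psi> 0 - \<phi> 0) < d"
      using norm_at_0_less[of "\<lambda>\<theta>. \<psi> \<theta> - \<phi> \<theta>" d] small d(1) by simp
    have i: "p_integrable p (lebesgue_on {-R..u}) (\<lambda>s. sol \<psi> s - sol \<phi> s)" for u
      using p_pos \<phi> \<psi> by (intro p_integrable_diff sol_p_integrable) auto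
    have "?E \<psi> (-R) (?T + r) = ?E \<psi> (-R) ?T + ?E \<psi> ?T (?T + r)"
      by (intro p_energy_combine i) (use T(1) r_pos r_le in linarith)+
    moreover have "?E \<psi> ?T (?T + r) \<le> (?T + r - ?T) * \<omega> powr p"
    proof (rule p_energy_le_bound)
      show "p_integrable p (lebesgue_on {?T..?T + r}) (\<lambda>s. sol \<psi> s - sol \<phi> s)"
        by (rule p_integrable_subinterval[OF i]) (use RT in auto)
      show "norm (sol \<psi> s - sol \<phi> s) \<le> \<omega>" if "s \<in> {?T..?T + r}" for s
        by (intro less_imp_le d(2) \<psi>) (use that order_trans[OF T(1)] near zero in auto)
    qed (use p_pos r_pos in auto)
    ultimately have "?E \<psi> (-R) (?T + r) < e" using near \<omega>(2) by simp
    then show "?E \<psi> (-R) (real (Suc n) * r) < e" using T(2) by simp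
  qed
qed

lemma continuous_dependence:
  assumes \<phi>: "\<phi> \<in> histories" and T: "0 \<le> T" and e: "0 < e"
  obtains d where "0 < d"
    "\<And>\<psi> t. \<lbrakk>\<psi> \<in> histories; history_energy p R (\<lambda>\<theta>. \<psi> \<theta> - \<phi> \<theta>) < d; t \<in> {0..T}\<rbrakk> \<Longrightarrow>
        history_energy p R (\<lambda>\<theta>. sol \<psi> (t + \<theta>) - sol \<phi> (t + \<theta>)) < e"
proof -
  obtain n :: nat where "T / r \<le> real n" using real_arch_simple by blast
  then have n: "T \<le> real n * r" using r_pos by (simp add: field_simps)
  let ?S = "real n * r"
  let ?E = "\<lambda>\<psi> a b. p_energy p (lebesgue_on {a..b}) (\<lambda>s. sol \<psi> s - sol \<phi> s)"
  define \<omega> where "\<omega> = (e / 2) powr (1 / p)"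
  have \<omega>: "0 < \<omega>" "\<omega> powr p = e / 2" using p_pos e by (auto simp: \<omega>_def powr_powr)
  have S: "0 \<le> ?S" using r_pos by simp
  obtain d where d: "0 < d" "\<And>\<psi> t. \<lbrakk>\<psi> \<in> histories; ?E \<psi> (-R) ?S < d;
        norm (\<psi> 0 - \<phi> 0) < d; t \<in> {0..?S + r}\<rbrakk> \<Longrightarrow> norm (sol \<psi> t - sol \<phi> t) < \<omega>"
    using dependence_step[OF \<phi> S \<omega>(1)] by blast
  obtain d' where d': "0 < d'" "\<And>\<psi>. \<psi> \<in> histories \<Longrightarrow> history_energy p R (\<lambda>\<theta>. \<psi> \<theta> - \<phi> \<theta>) < d' \<Longrightarrow>
      ?E \<psi> (-R) ?S < min d (e / 2)"
    using dependence_steps[OF \<phi>, of "min d (e / 2)" n] d(1) e by auto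
  show ?thesis
  proof (rule that[of "min d' (d powr p)"])
    show "0 < min d' (d powr p)" using d d' by simp
    fix \<psi> t assume \<psi>: "\<psi> \<in> histories" and t: "t \<in> {0..T}"
      and small: "history_energy p R (\<lambda>\<theta>. \<psi> \<theta> - \<phi> \<theta>) < min d' (d powr p)"
    have near: "?E \<psi> (-R) ?S < min d (e / 2)" using small by (intro d'(2) \<psi>) simp
    have zero: "norm (\<psi> 0 - \<phi> 0) < d"
      using norm_at_0_less[of "\<lambda>\<theta>. \<psi> \<theta> - \<phi> \<theta>" d] small d(1) by simp
    have i: "p_integrable p (lebesgue_on {-R..?S}) (\<lambda>s. sol \<psi> s - sol \<phi> s)"
      using p_pos \<phi> \<psi> by (intro p_integrable_diff sol_p_integrable) auto
    have "p_energy p (lebesgue_on {-R..0}) (\<lambda>\<theta>. sol \<psi> (t + \<theta>) - sol \<phi> (t + \<theta>)) = ?E \<psi> (-R + t) (0 + t)"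
      using p_energy_shift[of p "-R" 0 "\<lambda>s. sol \<psi> s - sol \<phi> s" t] by (simp add: add.commute)
    also have "\<dots> \<le> ?E \<psi> (-R) ?S" using t n by (intro p_energy_mono_interval[OF i]) auto
    finally have 1: "p_energy p (lebesgue_on {-R..0}) (\<lambda>\<theta>. sol \<psi> (t + \<theta>) - sol \<phi> (t + \<theta>)) < e / 2"
      using near by linarith
    have "norm (sol \<psi> t - sol \<phi> t) < \<omega>"
      using t n r_pos near zero by (intro d(2) \<psi>) auto
    then have "norm (sol \<psi> t - sol \<phi> t) powr p \<le> e / 2"
      using powr_mono2[of p "norm (sol \<psi> t - sol \<phi> t)" \<omega>] \<omega> p_pos by simp
    then show "history_energy p R (\<lambda>\<theta>. sol \<psi> (t + \<theta>) - sol \<phi> (t + \<theta>)) < e"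
      using 1 by (simp add: history_energy_def)
  qed
qed

text \<open>
  For times before \<open>R\<close> the segments still contain a piece of the initial history, which
  is only measurable. Their dependence on time is continuous by continuity of translations in
  the mean; the value at \<open>0\<close>, which is \<open>sol \<phi> t\<close>, is continuous by the equation.
\<close>

lemma continuous_in_time:
  assumes \<phi>: "\<phi> \<in> histories" and t: "0 \<le> t" and e: "0 < e"
  obtains d where "0 < d"
    "\<And>s. 0 \<le> s \<Longrightarrow> \<bar>s - t\<bar> < d \<Longrightarrow> history_energy p R (\<lambda>\<theta>. sol \<phi> (s + \<theta>) - sol \<phi> (t + \<theta>)) < e"
proof -
  define \<omega> where "\<omega> = (e / 2) powr (1 / p)"
  have \<omega>: "0 < \<omega>" "\<omega> powr p = e / 2" using p_pos e by (auto simp: \<omega>_def powr_powr)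
  have ab: "-R \<le> t + 1" and e2: "0 < e / 2" using t r_pos r_le e by auto
  obtain d where d: "0 < d"
    "\<And>l u c c'. \<lbrakk>l \<le> u; {l + c..u + c} \<subseteq> {-R..t + 1}; {l + c'..u + c'} \<subseteq> {-R..t + 1}; \<bar>c - c'\<bar> < d\<rbrakk>
       \<Longrightarrow> p_energy p (lebesgue_on {l..u}) (\<lambda>s. sol \<phi> (s + c) - sol \<phi> (s + c')) < e / 2"
    using translation_continuous[OF sol_p_integrable[OF \<phi>, of "t + 1"] p_pos e2 ab] by blast
  obtain d' where d': "0 < d'" "\<And>s. 0 \<le> s \<Longrightarrow> dist s t < d' \<Longrightarrow> dist (sol \<phi> s) (sol \<phi> t) < \<omega>"
    using sol_continuous[OF \<phi>] t \<omega>(1) unfolding continuous_on_iff by force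
  show ?thesis
  proof (rule that[of "min 1 (min d d')"])
    show "0 < min 1 (min d d')" using d d' by simp
    fix s assume s: "0 \<le> s" and near: "\<bar>s - t\<bar> < min 1 (min d d')"
    have "p_energy p (lebesgue_on {-R..0}) (\<lambda>\<theta>. sol \<phi> (\<theta> + s) - sol \<phi> (\<theta> + t)) < e / 2"
      using s t near r_pos r_le by (intro d(2)) auto
    moreover have "norm (sol \<phi> s - sol \<phi> t) powr p \<le> e / 2"
      using powr_mono2[of p "norm (sol \<phi> s - sol \<phi> t)" \<omega>] \<omega> p_pos d'(2)[OF s] near
      by (simp add: dist_norm)
    ultimately show "history_energy p R (\<lambda>\<theta>. sol \<phi> (s + \<theta>) - sol \<phi> (t + \<theta>)) < e"
      by (simp add: history_energy_def add.commute)
  qed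
qed

lemma jointly_continuous:
  assumes \<phi>: "\<phi> \<in> histories" and t: "0 \<le> t" and e: "0 < e"
  shows "\<exists>d>0. \<forall>s\<ge>0. \<forall>\<psi>\<in>histories. \<bar>s - t\<bar> < d \<longrightarrow> history_energy p R (\<lambda>\<theta>. \<psi> \<theta> - \<phi> \<theta>) < d \<longrightarrow>
     history_energy p R (\<lambda>\<theta>. solution_semiflow f R r (s, \<psi>) \<theta> - solution_semiflow f R r (t, \<phi>) \<theta>) < e"
proof -
  define \<eta> where "\<eta> = e / (2 * 2 powr p)"
  have \<eta>: "0 < \<eta>" using e by (simp add: \<eta>_def)
  have T: "0 \<le> t + 1" using t by simp
  obtain d where d: "0 < d"
    "\<And>\<psi> s. \<lbrakk>\<psi> \<in> histories; history_energy p R (\<lambda>\<theta>. \<psi> \<theta> - \<phi> \<theta>) < d; s \<in> {0..t + 1}\<rbrakk> \<Longrightarrow>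
        history_energy p R (\<lambda>\<theta>. sol \<psi> (s + \<theta>) - sol \<phi> (s + \<theta>)) < \<eta>"
    using continuous_dependence[OF \<phi> T \<eta>] by blast
  obtain d' where d': "0 < d'"
    "\<And>s. 0 \<le> s \<Longrightarrow> \<bar>s - t\<bar> < d' \<Longrightarrow> history_energy p R (\<lambda>\<theta>. sol \<phi> (s + \<theta>) - sol \<phi> (t + \<theta>)) < \<eta>"
    using continuous_in_time[OF \<phi> t \<eta>] by blast
  show ?thesis
  proof (intro exI[of _ "min 1 (min d d')"] conjI allI ballI impI)
    show "0 < min 1 (min d d')" using d d' by simp
    fix s \<psi> assume s: "0 \<le> s" "\<bar>s - t\<bar> < min 1 (min d d')" and \<psi>: "\<psi> \<in> histories"
      and small: "history_energy p R (\<lambda>\<theta>. \<psi> \<theta> - \<phi> \<theta>) < min 1 (min d d')"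
    have "history_energy p R (\<lambda>\<theta>. solution_semiflow f R r (s, \<psi>) \<theta> - solution_semiflow f R r (t, \<phi>) \<theta>)
        = history_energy p R (\<lambda>\<theta>. sol \<psi> (s + \<theta>) - sol \<phi> (t + \<theta>))"
      using r_pos r_le by (intro history_energy_cong) (auto simp: solution_semiflow_def history_def)
    also have "\<dots> \<le> 2 powr p * (history_energy p R (\<lambda>\<theta>. sol \<psi> (s + \<theta>) - sol \<phi> (s + \<theta>))
        + history_energy p R (\<lambda>\<theta>. sol \<phi> (s + \<theta>) - sol \<phi> (t + \<theta>)))"
      using p_pos s t \<phi> \<psi> by (intro history_energy_triangle p_integrable_sol_segment) auto
    also have "\<dots> < 2 powr p * (\<eta> + \<eta>)"
      using s small by (intro mult_strict_left_mono add_strict_mono d(2) d'(2) \<psi>) auto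
    also have "\<dots> = e" by (simp add: \<eta>_def)
    finally show "history_energy p R (\<lambda>\<theta>. solution_semiflow f R r (s, \<psi>) \<theta> - solution_semiflow f R r (t, \<phi>) \<theta>) < e" .
  qed
qed

end

text \<open>
  On a large ball \<open>f\<close> is bounded by compactness, and outside it the exponent \<open>\<alpha>\<close> may be raised to \<open>p\<close> at the
  expense of the summand 1.
\<close>

lemma growth_bound_global:
  fixes f :: "real ^ 'n \<Rightarrow> real ^ 'n"
  assumes nrm: "is_norm nrm" and f: "continuous_on UNIV f" and p: "0 < \<alpha>" "\<alpha> \<le> p"
    and C: "0 < C" and K: "\<And>x. nrm x \<ge> K \<Longrightarrow> nrm (f x) \<le> C * nrm x powr \<alpha>"
  obtains A where "\<And>u. norm (f u) \<le> A * (1 + norm u powr p)"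
proof -
  obtain a b where ab: "0 < a" "0 < b" "\<And>x. a * norm x \<le> nrm x" "\<And>x. nrm x \<le> b * norm x"
    using is_norm_equivalent[OF nrm] by metis
  have "compact (f ` cball 0 (\<bar>K\<bar> / a))"
    by (intro compact_continuous_image continuous_on_subset[OF f]) auto
  then obtain B where B: "\<And>x. norm x \<le> \<bar>K\<bar> / a \<Longrightarrow> norm (f x) \<le> B" "0 < B"
    using compact_imp_bounded bounded_pos by (metis imageI mem_cball_0)
  define D where "D = C * b powr \<alpha> / a"
  have D: "0 < D" using ab C by (simp add: D_def)
  have "norm (f u) \<le> (B + D) * (1 + norm u powr p)" for u
  proof (cases "norm u \<le> \<bar>K\<bar> / a")
    case True
    have "B * 1 \<le> (B + D) * (1 + norm u powr p)" using B D by (intro mult_mono) auto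
    then show ?thesis using B(1)[OF True] by simp
  next
    case False
    then have "K \<le> nrm u" using ab(1) ab(3)[of u] by (simp add: field_simps)
    have "a * norm (f u) \<le> nrm (f u)" by (rule ab)
    also have "\<dots> \<le> C * nrm u powr \<alpha>" by (rule K) fact
    also have "\<dots> \<le> C * (b * norm u) powr \<alpha>"
      using C p ab(4) is_norm_nonneg[OF nrm] by (intro mult_left_mono powr_mono2) auto
    also have "\<dots> = C * b powr \<alpha> * norm u powr \<alpha>" by (simp add: powr_mult)
    finally have "norm (f u) \<le> D * norm u powr \<alpha>" using ab(1) by (simp add: D_def field_simps)
    also have "norm u powr \<alpha> \<le> 1 + norm u powr p"
    proof (cases "norm u \<le> 1")
      case True
      then have "norm u powr \<alpha> \<le> 1" using p powr_mono2[of \<alpha> "norm u" 1] by simp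
      then show ?thesis by (simp add: add_increasing2)
    next
      case False
      then have "norm u powr \<alpha> \<le> norm u powr p" using p by (intro powr_mono) auto
      then show ?thesis by simp
    qed
    also have "D * (1 + norm u powr p) \<le> (B + D) * (1 + norm u powr p)"
      using B by (intro mult_right_mono) auto
    finally show ?thesis using D by simp
  qed
  then show ?thesis by (rule that)
qed

theorem theorem3p10:
  fixes nrm :: "real ^ 'n \<Rightarrow> real"
    and f :: "real ^ 'n \<Rightarrow> real ^ 'n"
    and R r \<alpha> p :: real
  assumes "is_norm nrm"
    and "R > 0" and "0 < r" and "r \<le> R"
    and "continuous_on UNIV f"
    and "\<alpha> \<ge> 1"
    and "\<exists>C>0. \<exists>K>0. \<forall>x. nrm x \<ge> K \<longrightarrow> nrm (f x) \<le> C * nrm x powr \<alpha>"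
    and "\<alpha> \<le> p"
  shows "continuous_semiflow (Lp_topology nrm p R) (solution_semiflow f R r)"
proof -
  have p: "0 < p" "0 < \<alpha>" using assms by auto
  obtain C K where "0 < C" "\<And>x. nrm x \<ge> K \<Longrightarrow> nrm (f x) \<le> C * nrm x powr \<alpha>"
    using assms(7) by blast
  then obtain A where A: "\<And>u. norm (f u) \<le> A * (1 + norm u powr p)"
    using growth_bound_global[OF assms(1,5) p(2) assms(8)] by blast
  interpret delay_equation f R r p A
    using assms p A by unfold_locales
  have L: "Lp_space nrm p R = histories"
    using Lp_space_eq[OF assms(1) p(1)] by (simp add: histories_def)
  show ?thesis
    unfolding continuous_semiflow_def topspace_Lp_topology
  proof
    show "semiflow (Lp_space nrm p R) (solution_semiflow f R r)"
      unfolding L by (rule semiflow_histories)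
    then have maps: "solution_semiflow f R r \<in> {0..} \<times> Lp_space nrm p R \<rightarrow> Lp_space nrm p R"
      by (simp add: semiflow_def)
    show "continuous_map (prod_topology (top_of_set {0..}) (Lp_topology nrm p R)) (Lp_topology nrm p R)
       (solution_semiflow f R r)"
      by (rule continuous_map_Lp_topologyI[OF assms(1) p(1) maps]) (unfold L, rule jointly_continuous)
  qed
qed

end
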